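(* For any integers $N>n\ge1$ there exists an integer $\mu=\mu(n,N)$ such that for every $k\ge\mu$ a Zariski generic real-algebraic hypersurface $M\subset\mathbb{C}^{n+1}$ of degree $k$ is not transversally holomorphically embeddable into a hyperquadric $\mathcal{Q}^{2N+1}\subset\mathbb{C}^{N+1}$. Moreover, one may choose explicitly $$\mu(n,N)=2+N-n+\binom{\frac{(N+1)(N+2)}{2}+p(N,n)}{p(N,n)},\qquad p(N,n)=n+\frac{n(n+1)}{2}\binom{N}{n}.$$
   Context: Hyperquadric: $\mathcal{Q}^{2N+1}\subset\mathbb{C}^{N+1}$ denotes any nondegenerate real hyperquadric $\operatorname{Im}W=-\sum_{j=1}^{l}|Z_j|^2+\sum_{j=l+1}^{N}|Z_j|^2$, $0\le l\le N$ (any signature). A real hypersurface $M\subset\mathbb{C}^{n+1}$ is transversally holomorphically embeddable into $\mathcal{Q}^{2N+1}$ if for some $p\in M$ there is a holomorphic embedding $F:U\to\mathbb{C}^{N+1}$ of an open neighborhood $U$ of $p$ in $\mathbb{C}^{n+1}$ with $F(M\cap U)\subset\mathcal{Q}^{2N+1}$ and $T_{F(p)}\mathcal{Q}^{2N+1}+dF(T_p\mathbb{C}^{n+1})=T_{F(p)}\mathbb{C}^{N+1}$ (real tangent spaces). Zariski generic: let $R_k$ be the finite-dimensional real vector space of real polynomials of degree $\le k$ on $\mathbb{C}^{n+1}=\mathbb{R}^{2n+2}$, and for $P\in R_k$ let $M_P$ be the real hypersurface $\{P=0,\ dP\ne0\}$. A property holds for a Zariski generic real-algebraic hypersurface of degree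 $k$ if it holds for $M_P$ for all $P\in R_k$ outside some proper Zariski-closed subset of $R_k$. *)

theory Defs
  imports "HOL-Analysis.Analysis" "HOL-Library.Poly_Mapping"
begin

section \<open>Real polynomials and Zariski genericity\<close>

text \<open>
  A real polynomial with variables in \<open>'v\<close> is an element of \<open>('v \<Rightarrow>\<^sub>0 nat) \<Rightarrow>\<^sub>0 real\<close>, a finitely
  supported family of coefficients indexed by monomials.
\<close>

definition polynomial_eval :: "(('v \<Rightarrow>\<^sub>0 nat) \<Rightarrow>\<^sub>0 real) \<Rightarrow> ('v \<Rightarrow> real) \<Rightarrow> real" where
  "polynomial_eval P x =
     (\<Sum>m\<in>Poly_Mapping.keys P. Poly_Mapping.lookup P m *
        (\<Prod>v\<in>Poly_Mapping.keys m. x v ^ Poly_Mapping.lookup m v))"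

definition monomial_degree :: "('v \<Rightarrow>\<^sub>0 nat) \<Rightarrow> nat" where
  "monomial_degree m = (\<Sum>v\<in>Poly_Mapping.keys m. Poly_Mapping.lookup m v)"

text \<open>
  The space \<open>R\<^sub>k\<close>. The variables are the vectors of the standard orthonormal basis, i.e. the
  coordinates on the underlying real Euclidean space; on \<open>complex ^ 'm\<close> these are the real and
  imaginary parts of the complex coordinates.
\<close>

definition real_polynomials :: "nat \<Rightarrow> (('a::euclidean_space \<Rightarrow>\<^sub>0 nat) \<Rightarrow>\<^sub>0 real) set" where
  "real_polynomials k =
     {P. \<forall>m\<in>Poly_Mapping.keys P. Poly_Mapping.keys m \<subseteq> Basis \<and> monomial_degree m \<le> k}"

definition polynomial_fun :: "(('a::euclidean_space \<Rightarrow>\<^sub>0 nat) \<Rightarrow>\<^sub>0 real) \<Rightarrow> 'a \<Rightarrow> real" where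
  "polynomial_fun P z = polynomial_eval P (\<lambda>b. z \<bullet> b)"

definition algebraic_hypersurface :: "(('a::euclidean_space \<Rightarrow>\<^sub>0 nat) \<Rightarrow>\<^sub>0 real) \<Rightarrow> 'a set" where
  "algebraic_hypersurface P =
     {z. polynomial_fun P z = 0 \<and> frechet_derivative (polynomial_fun P) (at z) \<noteq> (\<lambda>v. 0)}"

text \<open>
  The linear coordinates on \<open>R\<^sub>k\<close> are the coefficients, so a polynomial function on \<open>R\<^sub>k\<close> is a
  polynomial \<open>Q\<close> whose variables are monomials, evaluated at the coefficient family of \<open>P\<close>.
  Monomials of degree greater than \<open>k\<close> may occur in \<open>Q\<close>, but the corresponding
  coefficients vanish on \<open>R\<^sub>k\<close>.
\<close>

definition zariski_closed_in_polynomials ::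
    "nat \<Rightarrow> (('a::euclidean_space \<Rightarrow>\<^sub>0 nat) \<Rightarrow>\<^sub>0 real) set \<Rightarrow> bool" where
  "zariski_closed_in_polynomials k Z \<longleftrightarrow>
     (\<exists>S :: ((('a \<Rightarrow>\<^sub>0 nat) \<Rightarrow>\<^sub>0 nat) \<Rightarrow>\<^sub>0 real) set.
        Z = {P \<in> real_polynomials k. \<forall>Q\<in>S. polynomial_eval Q (Poly_Mapping.lookup P) = 0})"

definition zariski_generic_hypersurface :: "nat \<Rightarrow> ('a::euclidean_space set \<Rightarrow> bool) \<Rightarrow> bool" where
  "zariski_generic_hypersurface k property \<longleftrightarrow>
     (\<exists>Z. zariski_closed_in_polynomials k Z \<and> Z \<subset> real_polynomials k \<and>
        (\<forall>P \<in> real_polynomials k - Z. property (algebraic_hypersurface P)))"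


section \<open>Holomorphic embeddings\<close>

text \<open>
  In several variables, a map is holomorphic on an open set if it is Frechet differentiable
  there with complex-linear derivative.
\<close>

definition holomorphic_map_on ::
    "(complex ^ 'm::finite \<Rightarrow> complex ^ 'k::finite) \<Rightarrow> (complex ^ 'm) set \<Rightarrow> bool" where
  "holomorphic_map_on F U \<longleftrightarrow>
     open U \<and> (\<forall>z\<in>U. \<exists>D. (F has_derivative D) (at z) \<and> Vector_Spaces.linear (*s) (*s) D)"

definition holomorphic_embedding_on ::
    "(complex ^ 'm::finite \<Rightarrow> complex ^ 'k::finite) \<Rightarrow> (complex ^ 'm) set \<Rightarrow> bool" where
  "holomorphic_embedding_on F U \<longleftrightarrow>
     holomorphic_map_on F U \<and>
     (\<forall>z\<in>U. inj (frechet_derivative F (at z))) \<and>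
     (\<exists>G. homeomorphism U (F ` U) F G)"


section \<open>Hyperquadrics and transversal embeddability\<close>

text \<open>
  Points of \<open>\<complex>\<^bsup>N+1\<^esup>\<close> with \<open>N = CARD('k)\<close> are vectors indexed by \<open>'k option\<close>: the coordinate
  \<open>W\<close> has index \<open>None\<close> and the coordinates \<open>Z\<^sub>j\<close> have indices \<open>Some j\<close>. Since
  \<open>'k\<close> carries no order, the coordinates entering with a negative sign are given by an arbitrary
  set \<open>L\<close> of indices, \<open>card L = l\<close>, in place of \<open>{1..l}\<close>.
\<close>

definition hyperquadric_fun :: "'k::finite set \<Rightarrow> complex ^ 'k option \<Rightarrow> real" where
  "hyperquadric_fun L Z =
     Im (Z $ None) - (- (\<Sum>j\<in>L. (cmod (Z $ Some j))\<^sup>2) + (\<Sum>j\<in>-L. (cmod (Z $ Some j))\<^sup>2))"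

definition hyperquadric :: "'k::finite set \<Rightarrow> (complex ^ 'k option) set" where
  "hyperquadric L = {Z. hyperquadric_fun L Z = 0}"

text \<open>The real tangent space at \<open>q \<in> hyperquadric L\<close>, as the kernel of the differential of the
  defining function (which vanishes nowhere).\<close>

definition hyperquadric_tangent_space ::
    "'k::finite set \<Rightarrow> complex ^ 'k option \<Rightarrow> (complex ^ 'k option) set" where
  "hyperquadric_tangent_space L q = {v. frechet_derivative (hyperquadric_fun L) (at q) v = 0}"

definition transversally_embeddable :: "(complex ^ 'm::finite) set \<Rightarrow> 'k::finite set \<Rightarrow> bool" where
  "transversally_embeddable M L \<longleftrightarrow>
     (\<exists>p\<in>M. \<exists>U. \<exists>F :: complex ^ 'm \<Rightarrow> complex ^ 'k option.
        open U \<and> p \<in> U \<and> holomorphic_embedding_on F U \<and>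
        F ` (M \<inter> U) \<subseteq> hyperquadric L \<and>
        {u + w | u w. u \<in> hyperquadric_tangent_space L (F p) \<and>
                      w \<in> range (frechet_derivative F (at p))} = UNIV)"


section \<open>The explicit degree bound\<close>

definition p_bound :: "nat \<Rightarrow> nat \<Rightarrow> nat" where
  "p_bound N n = n + (n * (n + 1) div 2) * (N choose n)"

definition mu_bound :: "nat \<Rightarrow> nat \<Rightarrow> nat" where
  "mu_bound n N =
     2 + N - n + (((N + 1) * (N + 2) div 2 + p_bound N n) choose p_bound N n)"

end

theory Submission
  imports Defs "HOL-Complex_Analysis.Conformal_Mappings"
begin

text \<open>
  The proof is a dimension count. If \<open>P\<close> has degree at most \<open>k\<close> and the hypersurface \<open>P = 0\<close> is
  transversally embedded near \<open>p\<close> by \<open>F\<close>, then the pull-back \<open>\<Omega>\<close> of the hyperquadric equation under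
  \<open>F\<close> has nonzero differential at \<open>p\<close> and vanishes on \<open>P = 0\<close>, so \<open>P = b \<Omega>\<close> up to order \<open>k\<close> at \<open>p\<close>
  for some real polynomial \<open>b\<close> of degree less than \<open>k\<close>. Hence \<open>P\<close>, being its own \<open>k\<close>-jet, is the value
  of a fixed polynomial map at the parameters \<open>p\<close>, \<open>b\<close>, the \<open>k\<close>-jet of \<open>F\<close> and the signs of the
  hyperquadric. The coefficients of \<open>P\<close> exceed those of \<open>b\<close> in number by a quantity of order
  \<open>k\<^sup>2\<^sup>n\<^sup>+\<^sup>1\<close>, whereas \<open>F\<close>, being holomorphic, contributes only order \<open>k\<^sup>n\<^sup>+\<^sup>1\<close>; so for large \<open>k\<close> there are
  fewer parameters than coefficients and the coefficients satisfy a nontrivial algebraic relation.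
\<close>

section \<open>Polynomial functions in finitely many variables\<close>

text \<open>Dividing by the quadric equation is what makes the count work. By Pascal's rule the
  multiplier accounts for all but \<open>(2n+1+k) choose (2n+1)\<close> coefficients of
  \<open>P\<close>, against \<open>2 (N+1) ((n+1+k) choose (n+1))\<close> real coefficients of the
  map; the first number has the larger degree in k exactly because n >= 1. With base point and signs
  included, k >= (n+2)(2N+3) suffices, and \<open>mu_bound\<close> enters only through the fact that
  it exceeds this threshold.

  The embedding is an arbitrary germ, at any point and into any signature. Point and signs are
  therefore parameters too, and one relation serves them all. It comes from comparing numbers of
  monomials, in place of a dimension theory for images of polynomial maps.

  The division needs no structure theory of analytic hypersurfaces: formal division leaves a
  remainder on a hyperplane, and testing it along zeros of \<open>P\<close> supplied by the
  intermediate value theorem kills it. The equality obtained is one of functions; interpolation on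
  an integer grid turns it into one of coefficients.\<close>

definition cube_exponents :: "'v set \<Rightarrow> nat \<Rightarrow> ('v \<Rightarrow> nat) set" where
  "cube_exponents V e = {\<gamma>. (\<forall>v\<in>V. \<gamma> v \<le> e) \<and> (\<forall>v. v \<notin> V \<longrightarrow> \<gamma> v = 0)}"

definition degree_exponents :: "'v set \<Rightarrow> nat \<Rightarrow> ('v \<Rightarrow> nat) set" where
  "degree_exponents V k = {\<gamma>. (\<forall>v. v \<notin> V \<longrightarrow> \<gamma> v = 0) \<and> sum \<gamma> V \<le> k}"

lemma cube_exponents_bij:
  "bij_betw (\<lambda>\<gamma>. restrict \<gamma> V) (cube_exponents V e) (PiE V (\<lambda>_. {..e}))"
  by (rule bij_betw_byWitness[where f' = "\<lambda>\<gamma> v. if v \<in> V then \<gamma> v else 0"])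
     (auto simp: cube_exponents_def fun_eq_iff PiE_def extensional_def)

lemma finite_cube_exponents: "finite V \<Longrightarrow> finite (cube_exponents V e)"
  using bij_betw_finite[OF cube_exponents_bij] by (metis finite_PiE finite_atMost)

lemma card_cube_exponents: "finite V \<Longrightarrow> card (cube_exponents V e) = (e + 1) ^ card V"
  using bij_betw_same_card[OF cube_exponents_bij[of V e]] by (simp add: card_PiE)

lemma degree_exponents_subset_cube: "finite V \<Longrightarrow> degree_exponents V k \<subseteq> cube_exponents V k"
  unfolding degree_exponents_def cube_exponents_def
  by (auto intro: order_trans[OF member_le_sum])

lemma finite_degree_exponents: "finite V \<Longrightarrow> finite (degree_exponents V k)"
  by (meson degree_exponents_subset_cube finite_cube_exponents finite_subset)

text \<open>Bounding each exponent separately makes the exponent set a product of intervals, so that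
  one-variable facts pass to several variables by expanding a product.\<close>

lemma prod_sum_cube_exponents:
  fixes g :: "'v \<Rightarrow> nat \<Rightarrow> 'b::comm_semiring_1"
  assumes "finite V"
  shows "(\<Prod>v\<in>V. \<Sum>j\<le>e. g v j) = (\<Sum>J\<in>cube_exponents V e. \<Prod>v\<in>V. g v (J v))"
proof -
  have "(\<Prod>v\<in>V. \<Sum>j\<le>e. g v j) = (\<Sum>J\<in>PiE V (\<lambda>_. {..e}). \<Prod>v\<in>V. g v (J v))"
    using assms by (subst prod_sum_PiE) auto
  also have "\<dots> = (\<Sum>J\<in>cube_exponents V e. \<Prod>v\<in>V. g v (restrict J V v))"
    by (rule sum.reindex_bij_betw[OF cube_exponents_bij, symmetric])
  finally show ?thesis by simp
qed

text \<open>\<open>X a v\<close> is the value of the variable \<open>v\<close> at the point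
  \<open>a\<close>. One notion thus covers polynomials in abstract parameters, in the complex
  coordinates of a vector and in its real coordinates.\<close>

definition spanned_by_monomials ::
    "('a \<Rightarrow> 'v \<Rightarrow> 'b::comm_semiring_1) \<Rightarrow> 'v set \<Rightarrow> ('v \<Rightarrow> nat) set \<Rightarrow> ('a \<Rightarrow> 'b) \<Rightarrow> bool" where
  "spanned_by_monomials X V \<Gamma> f \<longleftrightarrow>
     (\<exists>c. \<forall>a. f a = (\<Sum>\<gamma>\<in>\<Gamma>. c \<gamma> * (\<Prod>v\<in>V. X a v ^ \<gamma> v)))"

lemma spanned_by_monomials_zero: "spanned_by_monomials X V \<Gamma> (\<lambda>_. 0)"
  unfolding spanned_by_monomials_def by (rule exI[of _ "\<lambda>_. 0"]) simp

lemma spanned_by_monomials_monomial: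
  assumes "finite \<Gamma>" "\<gamma> \<in> \<Gamma>"
  shows "spanned_by_monomials X V \<Gamma> (\<lambda>a. c * (\<Prod>v\<in>V. X a v ^ \<gamma> v))"
  unfolding spanned_by_monomials_def
  by (rule exI[of _ "\<lambda>\<delta>. if \<delta> = \<gamma> then c else 0"])
     (simp add: if_distrib[of "\<lambda>x. x * _"] sum.delta assms cong: if_cong)

lemma spanned_by_monomials_add:
  assumes "spanned_by_monomials X V \<Gamma> f" "spanned_by_monomials X V \<Gamma> g"
  shows "spanned_by_monomials X V \<Gamma> (\<lambda>a. f a + g a)"
proof -
  obtain c d where "\<forall>a. f a = (\<Sum>\<gamma>\<in>\<Gamma>. c \<gamma> * (\<Prod>v\<in>V. X a v ^ \<gamma> v))"
    and "\<forall>a. g a = (\<Sum>\<gamma>\<in>\<Gamma>. d \<gamma> * (\<Prod>v\<in>V. X a v ^ \<gamma> v))"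
    using assms unfolding spanned_by_monomials_def by blast
  then show ?thesis unfolding spanned_by_monomials_def
    by (intro exI[of _ "\<lambda>\<gamma>. c \<gamma> + d \<gamma>"]) (simp add: sum.distrib algebra_simps)
qed

lemma spanned_by_monomials_sum:
  assumes "\<And>i. i \<in> I \<Longrightarrow> spanned_by_monomials X V \<Gamma> (f i)"
  shows "spanned_by_monomials X V \<Gamma> (\<lambda>a. \<Sum>i\<in>I. f i a)"
  using assms
  by (induction I rule: infinite_finite_induct)
     (auto intro: spanned_by_monomials_zero spanned_by_monomials_add)

lemma spanned_by_monomials_mult:
  assumes f: "spanned_by_monomials X V \<Gamma> f" and g: "spanned_by_monomials X V \<Delta> g"
    and \<Theta>: "finite \<Theta>" "\<And>\<gamma> \<delta>. \<gamma> \<in> \<Gamma> \<Longrightarrow> \<delta> \<in> \<Delta> \<Longrightarrow> (\<lambda>v. \<gamma> v + \<delta> v) \<in> \<Theta>"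
  shows "spanned_by_monomials X V \<Theta> (\<lambda>a. f a * g a)"
proof -
  obtain c d where c: "\<And>a. f a = (\<Sum>\<gamma>\<in>\<Gamma>. c \<gamma> * (\<Prod>v\<in>V. X a v ^ \<gamma> v))"
    and d: "\<And>a. g a = (\<Sum>\<gamma>\<in>\<Delta>. d \<gamma> * (\<Prod>v\<in>V. X a v ^ \<gamma> v))"
    using f g unfolding spanned_by_monomials_def by blast
  have "f a * g a = (\<Sum>\<gamma>\<in>\<Gamma>. \<Sum>\<delta>\<in>\<Delta>. c \<gamma> * d \<delta> * (\<Prod>v\<in>V. X a v ^ (\<gamma> v + \<delta> v)))" for a
    by (simp add: c d sum_product power_add prod.distrib mult_ac)
  then have eq: "(\<lambda>a. f a * g a) = (\<lambda>a. \<Sum>\<gamma>\<in>\<Gamma>. \<Sum>\<delta>\<in>\<Delta>. c \<gamma> * d \<delta> * (\<Prod>v\<in>V. X a v ^ (\<gamma> v + \<delta> v)))"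
    by (rule ext)
  show ?thesis unfolding eq
    by (intro spanned_by_monomials_sum spanned_by_monomials_monomial[OF \<Theta>(1)] \<Theta>(2))
qed

lemma spanned_by_monomials_mono:
  assumes "spanned_by_monomials X V \<Gamma> f" "\<Gamma> \<subseteq> \<Delta>" "finite \<Delta>"
  shows "spanned_by_monomials X V \<Delta> f"
proof -
  obtain c where "f = (\<lambda>a. \<Sum>\<gamma>\<in>\<Gamma>. c \<gamma> * (\<Prod>v\<in>V. X a v ^ \<gamma> v))"
    using assms(1) unfolding spanned_by_monomials_def by blast
  then show ?thesis using assms(2,3)
    by (simp only:) (rule spanned_by_monomials_sum, rule spanned_by_monomials_monomial, auto)
qed

lemma spanned_by_monomials_const:
  assumes "finite \<Gamma>" "(\<lambda>_. 0) \<in> \<Gamma>"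
  shows "spanned_by_monomials X V \<Gamma> (\<lambda>_. c)"
  using spanned_by_monomials_monomial[OF assms, of X V c] by simp

lemma spanned_by_monomials_var:
  assumes "finite \<Gamma>" "finite V" "v \<in> V" "(\<lambda>w. if w = v then 1 else 0) \<in> \<Gamma>"
  shows "spanned_by_monomials X V \<Gamma> (\<lambda>a. X a v)"
proof -
  have "(\<Prod>w\<in>V. X a w ^ (if w = v then 1 else 0)) = X a v" for a
    using prod.delta[OF assms(2), of v "X a"] assms(3)
    by (simp add: if_distrib[of "power _"] cong: if_cong)
  then show ?thesis
    using spanned_by_monomials_monomial[OF assms(1,4), of X V 1] by simp
qed

abbreviation spanned_by_cube :: "'v set \<Rightarrow> nat \<Rightarrow> (('v \<Rightarrow> real) \<Rightarrow> real) \<Rightarrow> bool" where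
  "spanned_by_cube V e \<equiv> spanned_by_monomials (\<lambda>y. y) V (cube_exponents V e)"

lemma spanned_by_cube_const: "finite V \<Longrightarrow> spanned_by_cube V e (\<lambda>_. c)"
  by (rule spanned_by_monomials_const[OF finite_cube_exponents]) (auto simp: cube_exponents_def)

lemma spanned_by_cube_mult:
  assumes "finite V" "spanned_by_cube V d f" "spanned_by_cube V e g"
  shows "spanned_by_cube V (d + e) (\<lambda>y. f y * g y)"
  by (rule spanned_by_monomials_mult[OF assms(2,3) finite_cube_exponents[OF assms(1)]])
     (auto simp: cube_exponents_def add_mono)

lemma spanned_by_cube_mono:
  assumes "finite V" "spanned_by_cube V d f" "d \<le> e"
  shows "spanned_by_cube V e f"
  by (rule spanned_by_monomials_mono[OF assms(2) _ finite_cube_exponents[OF assms(1)]])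
     (use assms(3) in \<open>auto simp: cube_exponents_def intro: order_trans\<close>)

lemma spanned_by_cube_power:
  assumes "finite V" "spanned_by_cube V e f"
  shows "spanned_by_cube V (e * j) (\<lambda>y. f y ^ j)"
proof (induction j)
  case 0
  show ?case using spanned_by_cube_const[OF assms(1), of _ 1] by simp
next
  case (Suc j)
  show ?case using spanned_by_cube_mult[OF assms(1,2) Suc.IH] by simp
qed

lemma spanned_by_cube_prod:
  assumes "finite V" "finite I" "\<And>i. i \<in> I \<Longrightarrow> spanned_by_cube V e (f i)"
  shows "spanned_by_cube V (e * card I) (\<lambda>y. \<Prod>i\<in>I. f i y)"
  using assms(2,3)
proof (induction I rule: finite_induct)
  case empty
  show ?case using spanned_by_cube_const[OF assms(1), of _ 1] by simp
next
  case (insert i I)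
  show ?case using spanned_by_cube_mult[OF assms(1), of e "f i" "e * card I" "\<lambda>y. \<Prod>i\<in>I. f i y"] insert
    by simp
qed

definition polynomial_in :: "'v set \<Rightarrow> (('v \<Rightarrow> real) \<Rightarrow> real) \<Rightarrow> bool" where
  "polynomial_in V f \<longleftrightarrow> finite V \<and> (\<exists>e. spanned_by_cube V e f)"

lemma polynomial_in_const: "finite V \<Longrightarrow> polynomial_in V (\<lambda>_. c)"
  unfolding polynomial_in_def using spanned_by_cube_const by blast

lemma polynomial_in_var: "finite V \<Longrightarrow> v \<in> V \<Longrightarrow> polynomial_in V (\<lambda>y. y v)"
  unfolding polynomial_in_def
  by (intro conjI exI[of _ 1] spanned_by_monomials_var finite_cube_exponents)
     (auto simp: cube_exponents_def)

lemma polynomial_in_add: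
  assumes "polynomial_in V f" "polynomial_in V g"
  shows "polynomial_in V (\<lambda>y. f y + g y)"
proof -
  obtain d e where "finite V" "spanned_by_cube V d f" "spanned_by_cube V e g"
    using assms unfolding polynomial_in_def by blast
  then have "spanned_by_cube V (max d e) f" "spanned_by_cube V (max d e) g"
    by (auto intro: spanned_by_cube_mono)
  then show ?thesis
    unfolding polynomial_in_def using \<open>finite V\<close> spanned_by_monomials_add by blast
qed

lemma polynomial_in_mult:
  assumes "polynomial_in V f" "polynomial_in V g"
  shows "polynomial_in V (\<lambda>y. f y * g y)"
  using assms unfolding polynomial_in_def by (blast intro: spanned_by_cube_mult)

lemma polynomial_in_diff:
  assumes "polynomial_in V f" "polynomial_in V g"
  shows "polynomial_in V (\<lambda>y. f y - g y)"
proof -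
  have "finite V" using assms unfolding polynomial_in_def by blast
  then show ?thesis
    using polynomial_in_add[OF assms(1) polynomial_in_mult[OF polynomial_in_const[of V "-1"] assms(2)]]
    by simp
qed

lemma polynomial_in_sum:
  assumes "finite V" "\<And>i. i \<in> I \<Longrightarrow> polynomial_in V (f i)"
  shows "polynomial_in V (\<lambda>y. \<Sum>i\<in>I. f i y)"
  using assms(2)
  by (induction I rule: infinite_finite_induct)
     (auto intro: polynomial_in_add polynomial_in_const[OF assms(1)])

lemma polynomial_in_prod:
  assumes "finite V" "\<And>i. i \<in> I \<Longrightarrow> polynomial_in V (f i)"
  shows "polynomial_in V (\<lambda>y. \<Prod>i\<in>I. f i y)"
  using assms(2)
  by (induction I rule: infinite_finite_induct)
     (auto intro: polynomial_in_mult polynomial_in_const[OF assms(1)])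

lemma polynomial_in_power:
  assumes "polynomial_in V f" shows "polynomial_in V (\<lambda>y. f y ^ j)"
  using assms unfolding polynomial_in_def by (blast intro: spanned_by_cube_power)

subsection \<open>Extraction of coefficients from values on a grid\<close>

text \<open>The weights form the inverse Vandermonde matrix of the nodes 0, ..., e:
  \<open>w i j\<close> is the coefficient of degree \<open>i\<close> of the Lagrange polynomial at
  \<open>j\<close>. The identity says that interpolation reproduces a monomial of degree at most
  \<open>e\<close>, since two polynomials of that degree agree once they agree at
  \<open>e + 1\<close> nodes.\<close>

lemma Lagrange_coefficient_weights:
  "\<exists>w :: nat \<Rightarrow> nat \<Rightarrow> real. \<forall>i\<le>e. \<forall>l\<le>e. (\<Sum>j\<le>e. w i j * real j ^ l) = (if i = l then 1 else 0)"
proof -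
  define lagr :: "nat \<Rightarrow> real poly" where
    "lagr j = smult (1 / (\<Prod>i\<in>{..e}-{j}. real j - real i)) (\<Prod>i\<in>{..e}-{j}. [:- real i, 1:])" for j
  have lagr: "poly (lagr j) (real i) = (if i = j then 1 else 0)" if "i \<le> e" "j \<le> e" for i j
  proof (cases "i = j")
    case True
    have "(\<Prod>i\<in>{..e}-{j}. real j - real i) \<noteq> 0" by auto
    then show ?thesis using True by (simp add: lagr_def poly_prod)
  next
    case False
    then have "(\<Prod>l\<in>{..e}-{j}. poly [:- real l, 1:] (real i)) = 0"
      using that by (intro prod_zero) auto
    then show ?thesis using False by (simp add: lagr_def poly_prod)
  qed
  have deg: "degree (lagr j) \<le> e" if "j \<le> e" for j
  proof -
    have "degree (\<Prod>i\<in>{..e}-{j}. [:- real i, 1:]) \<le> sum (degree \<circ> (\<lambda>i. [:- real i, 1:])) ({..e}-{j})"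
      by (rule degree_prod_sum_le) simp
    also have "\<dots> = e" using that by simp
    finally show ?thesis unfolding lagr_def by (meson degree_smult_le order_trans)
  qed
  have "(\<Sum>j\<le>e. coeff (lagr j) i * real j ^ l) = (if i = l then 1 else 0)" if "i \<le> e" "l \<le> e" for i l
  proof -
    have "(\<Sum>j\<le>e. smult (real j ^ l) (lagr j)) = monom 1 l"
    proof (rule poly_eqI_degree[where A = "real ` {..e}"])
      have "degree (\<Sum>j\<le>e. smult (real j ^ l) (lagr j)) \<le> e"
        by (rule degree_sum_le) (use deg degree_smult_le order_trans in blast)+
      then show "degree (\<Sum>j\<le>e. smult (real j ^ l) (lagr j)) < card (real ` {..e})"
        by (simp add: card_image)
      show "degree (monom (1::real) l) < card (real ` {..e})"
        using that by (simp add: degree_monom_eq card_image)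
      fix x assume "x \<in> real ` {..e}"
      then obtain i where i: "i \<le> e" "x = real i" by auto
      then show "poly (\<Sum>j\<le>e. smult (real j ^ l) (lagr j)) x = poly (monom 1 l) x"
        by (simp add: poly_sum lagr poly_monom if_distrib[of "\<lambda>t. _ * t"] cong: if_cong)
    qed
    then have "coeff (\<Sum>j\<le>e. smult (real j ^ l) (lagr j)) i = coeff (monom 1 l) i" by simp
    then show ?thesis by (simp add: coeff_sum mult.commute)
  qed
  then show ?thesis by (intro exI[of _ "\<lambda>i j. coeff (lagr j) i"]) auto
qed

text \<open>Products of the one-variable weights. The lemma is used twice: to write coefficients as
  linear combinations of values, and to show that a polynomial vanishing on the grid has zero
  coefficients.\<close>

lemma grid_coefficient_weights:
  assumes "finite V"
  obtains W :: "('v \<Rightarrow> nat) \<Rightarrow> ('v \<Rightarrow> nat) \<Rightarrow> real"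
  where "\<And>c \<alpha>. \<alpha> \<in> cube_exponents V e \<Longrightarrow>
    (\<Sum>J\<in>cube_exponents V e. W \<alpha> J * (\<Sum>\<gamma>\<in>cube_exponents V e. c \<gamma> * (\<Prod>v\<in>V. real (J v) ^ \<gamma> v))) = c \<alpha>"
proof -
  obtain w :: "nat \<Rightarrow> nat \<Rightarrow> real" where w:
    "\<And>i l. i \<le> e \<Longrightarrow> l \<le> e \<Longrightarrow> (\<Sum>j\<le>e. w i j * real j ^ l) = (if i = l then 1 else 0)"
    using Lagrange_coefficient_weights by metis
  define W where "W \<alpha> J = (\<Prod>v\<in>V. w (\<alpha> v) (J v))" for \<alpha> J
  let ?C = "cube_exponents V e"
  have orth: "(\<Sum>J\<in>?C. W \<alpha> J * (\<Prod>v\<in>V. real (J v) ^ \<gamma> v)) = (if \<alpha> = \<gamma> then 1 else 0)"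
    if "\<alpha> \<in> ?C" "\<gamma> \<in> ?C" for \<alpha> \<gamma>
  proof -
    have "(\<Sum>J\<in>?C. W \<alpha> J * (\<Prod>v\<in>V. real (J v) ^ \<gamma> v)) = (\<Prod>v\<in>V. \<Sum>j\<le>e. w (\<alpha> v) j * real j ^ \<gamma> v)"
      by (simp add: W_def prod_sum_cube_exponents[OF assms] prod.distrib)
    also have "\<dots> = (\<Prod>v\<in>V. if \<alpha> v = \<gamma> v then 1 else 0)"
      using that by (intro prod.cong refl w) (auto simp: cube_exponents_def)
    also have "\<dots> = (if \<forall>v\<in>V. \<alpha> v = \<gamma> v then 1 else 0)"
      using assms by (auto intro!: prod.neutral prod_zero)
    also have "(\<forall>v\<in>V. \<alpha> v = \<gamma> v) \<longleftrightarrow> \<alpha> = \<gamma>"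
    proof -
      have "\<alpha> v = \<gamma> v" if "v \<notin> V" for v
        using that \<open>\<alpha> \<in> ?C\<close> \<open>\<gamma> \<in> ?C\<close> by (simp add: cube_exponents_def)
      then show ?thesis by (auto simp: fun_eq_iff)
    qed
    finally show ?thesis .
  qed
  have "(\<Sum>J\<in>?C. W \<alpha> J * (\<Sum>\<gamma>\<in>?C. c \<gamma> * (\<Prod>v\<in>V. real (J v) ^ \<gamma> v))) = c \<alpha>"
    if "\<alpha> \<in> ?C" for c \<alpha>
  proof -
    have "(\<Sum>J\<in>?C. W \<alpha> J * (\<Sum>\<gamma>\<in>?C. c \<gamma> * (\<Prod>v\<in>V. real (J v) ^ \<gamma> v))) =
          (\<Sum>\<gamma>\<in>?C. c \<gamma> * (\<Sum>J\<in>?C. W \<alpha> J * (\<Prod>v\<in>V. real (J v) ^ \<gamma> v)))"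
      unfolding sum_distrib_left by (subst sum.swap) (simp add: mult_ac)
    also have "\<dots> = (\<Sum>\<gamma>\<in>?C. c \<gamma> * (if \<alpha> = \<gamma> then 1 else 0))"
      using that orth by (intro sum.cong) auto
    also have "\<dots> = c \<alpha>"
      using that finite_cube_exponents[OF assms]
      by (simp add: if_distrib[of "\<lambda>t. _ * t"] cong: if_cong)
    finally show ?thesis .
  qed
  then show ?thesis using that by blast
qed

subsection \<open>Algebraic dependence of more polynomials than variables\<close>

text \<open>Gaussian elimination: equation \<open>j\<close> is solved for an unknown
  \<open>p\<close> with nonzero coefficient, and the remaining equations are rewritten without that
  unknown.\<close>

lemma underdetermined_homogeneous_system:
  fixes M :: "'i \<Rightarrow> 'j \<Rightarrow> 'b::field"
  assumes "finite J" "finite I" "card J < card I"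
  shows "\<exists>c. (\<exists>i\<in>I. c i \<noteq> 0) \<and> (\<forall>j\<in>J. (\<Sum>i\<in>I. c i * M i j) = 0)"
  using assms
proof (induction J arbitrary: I M rule: finite_induct)
  case empty
  then obtain i where "i \<in> I" by fastforce
  then show ?case by (intro exI[of _ "\<lambda>_. 1"]) auto
next
  case (insert j J)
  show ?case
  proof (cases "\<forall>i\<in>I. M i j = 0")
    case True
    obtain c where "\<exists>i\<in>I. c i \<noteq> 0" "\<forall>j\<in>J. (\<Sum>i\<in>I. c i * M i j) = 0"
      using insert by (metis Suc_lessD card_insert_disjoint)
    then show ?thesis using True by (intro exI[of _ c]) auto
  next
    case False
    then obtain p where p: "p \<in> I" "M p j \<noteq> 0" by blast
    let ?I = "I - {p}"
    have "card J < card ?I" using insert p by simp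
    then obtain c where c: "\<exists>i\<in>?I. c i \<noteq> 0"
      and c0: "\<forall>l\<in>J. (\<Sum>i\<in>?I. c i * (M i l - M i j / M p j * M p l)) = 0"
      using insert.IH[of ?I "\<lambda>i l. M i l - M i j / M p j * M p l"] insert.prems by blast
    \<comment> \<open>The value at the pivot is the one forced by equation \<open>j\<close>.\<close>
    define d where "d i = (if i = p then - (\<Sum>i\<in>?I. c i * M i j) / M p j else c i)" for i
    have split: "(\<Sum>i\<in>I. d i * M i l) = d p * M p l + (\<Sum>i\<in>?I. c i * M i l)" for l
      using sum.remove[OF insert.prems(1) p(1), of "\<lambda>i. d i * M i l"] by (simp add: d_def)
    have "(\<Sum>i\<in>I. d i * M i l) = 0" if "l \<in> insert j J" for l
    proof (cases "l = j")
      case True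
      then show ?thesis using p(2) unfolding split by (simp add: d_def)
    next
      case False
      then have "0 = (\<Sum>i\<in>?I. c i * (M i l - M i j / M p j * M p l))" using c0 that by auto
      also have "\<dots> = (\<Sum>i\<in>?I. c i * M i l) - (\<Sum>i\<in>?I. c i * M i j) * (M p l / M p j)"
        by (simp add: right_diff_distrib sum_subtractf sum_distrib_right sum_divide_distrib mult.assoc)
      finally show ?thesis unfolding split by (simp add: d_def)
    qed
    moreover have "\<exists>i\<in>I. d i \<noteq> 0" using c by (auto simp: d_def)
    ultimately show ?thesis by blast
  qed
qed

text \<open>The products of the given polynomials with exponents up to \<open>D\<close> number
  \<open>(D + 1) ^ card X\<close>, yet they all lie in a space whose dimension grows only like
  \<open>D ^ card Y\<close>. For large \<open>D\<close> they are linearly dependent.\<close>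

lemma algebraic_dependence:
  assumes "finite X" "finite Y" "card Y < card X"
    and poly: "\<And>x. x \<in> X \<Longrightarrow> polynomial_in Y (\<psi> x)"
  shows "\<exists>D c. (\<exists>\<beta>\<in>cube_exponents X D. c \<beta> \<noteq> 0) \<and>
           (\<forall>y. (\<Sum>\<beta>\<in>cube_exponents X D. c \<beta> * (\<Prod>x\<in>X. \<psi> x y ^ \<beta> x)) = 0)"
proof -
  have "\<forall>x\<in>X. \<exists>e. spanned_by_cube Y e (\<psi> x)" using poly unfolding polynomial_in_def by blast
  then obtain e where e: "\<And>x. x \<in> X \<Longrightarrow> spanned_by_cube Y (e x) (\<psi> x)" by metis
  define m where "m = sum e X"
  have m: "spanned_by_cube Y m (\<psi> x)" if "x \<in> X" for x
    using spanned_by_cube_mono[OF assms(2) e[OF that]] that assms(1)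
    by (simp add: m_def member_le_sum)
  \<comment> \<open>With \<open>K = m * D * card X\<close> one has
    \<open>K + 1 <= (m * card X + 1) * (D + 1)\<close>. Its power \<open>card Y\<close> is at most
    \<open>D * (D + 1) ^ card Y\<close> for this \<open>D\<close>, hence less than
    \<open>(D + 1) ^ (card Y + 1)\<close>.\<close>
  define D where "D = (m * card X + 1) ^ card Y"
  define K where "K = m * D * card X"
  have span: "spanned_by_cube Y K (\<lambda>y. \<Prod>x\<in>X. \<psi> x y ^ \<beta> x)" if "\<beta> \<in> cube_exponents X D" for \<beta>
    unfolding K_def
  proof (rule spanned_by_cube_prod[OF assms(2,1)])
    fix x assume "x \<in> X"
    then show "spanned_by_cube Y (m * D) (\<lambda>y. \<psi> x y ^ \<beta> x)"
      using spanned_by_cube_mono[OF assms(2) spanned_by_cube_power[OF assms(2) m]] that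
      by (auto simp: cube_exponents_def)
  qed
  then obtain M where M: "\<And>\<beta> y. \<beta> \<in> cube_exponents X D \<Longrightarrow>
      (\<Prod>x\<in>X. \<psi> x y ^ \<beta> x) = (\<Sum>\<gamma>\<in>cube_exponents Y K. M \<beta> \<gamma> * (\<Prod>v\<in>Y. y v ^ \<gamma> v))"
    unfolding spanned_by_monomials_def by metis
  have "(K + 1) ^ card Y \<le> ((m * card X + 1) * (D + 1)) ^ card Y"
    by (rule power_mono) (auto simp: K_def algebra_simps)
  also have "\<dots> = D * (D + 1) ^ card Y" by (simp only: D_def power_mult_distrib)
  also have "\<dots> < (D + 1) ^ Suc (card Y)" by simp
  also have "\<dots> \<le> (D + 1) ^ card X" using assms(3) by (intro power_increasing) auto
  finally have "card (cube_exponents Y K) < card (cube_exponents X D)"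
    by (simp only: card_cube_exponents assms(1,2))
  then obtain c where c: "\<exists>\<beta>\<in>cube_exponents X D. c \<beta> \<noteq> 0"
    and c0: "\<And>\<gamma>. \<gamma> \<in> cube_exponents Y K \<Longrightarrow> (\<Sum>\<beta>\<in>cube_exponents X D. c \<beta> * M \<beta> \<gamma>) = 0"
    using underdetermined_homogeneous_system[of "cube_exponents Y K" "cube_exponents X D" M]
      finite_cube_exponents assms(1,2) by metis
  have "(\<Sum>\<beta>\<in>cube_exponents X D. c \<beta> * (\<Prod>x\<in>X. \<psi> x y ^ \<beta> x)) = 0" for y
  proof -
    have "(\<Sum>\<beta>\<in>cube_exponents X D. c \<beta> * (\<Prod>x\<in>X. \<psi> x y ^ \<beta> x)) =
      (\<Sum>\<beta>\<in>cube_exponents X D. c \<beta> * (\<Sum>\<gamma>\<in>cube_exponents Y K. M \<beta> \<gamma> * (\<Prod>v\<in>Y. y v ^ \<gamma> v)))"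
      using M by simp
    also have "\<dots> = (\<Sum>\<gamma>\<in>cube_exponents Y K. (\<Sum>\<beta>\<in>cube_exponents X D. c \<beta> * M \<beta> \<gamma>) * (\<Prod>v\<in>Y. y v ^ \<gamma> v))"
      unfolding sum_distrib_left sum_distrib_right by (subst sum.swap) (simp add: mult_ac)
    finally show ?thesis by (simp add: c0)
  qed
  then show ?thesis using c by blast
qed

section \<open>Taylor polynomials of holomorphic functions of several variables\<close>

text \<open>The singularity at 0 is removable. The quotient is not directly controlled near 0, but
  on a circle of radius at least \<open>r / 2\<close> it is at most \<open>2 * M / (r / 2)\<close>,
  and the maximum principle carries this bound inside.\<close>

lemma holomorphic_difference_quotient:
  fixes r :: real
  assumes hol: "\<phi> holomorphic_on ball 0 r" and bound: "\<And>s. s \<in> ball 0 r \<Longrightarrow> cmod (\<phi> s) \<le> M"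
    and q_def: "q = (\<lambda>s. if s = 0 then deriv \<phi> 0 else (\<phi> s - \<phi> 0) / s)"
  shows "q holomorphic_on ball 0 r" and "\<And>s. s \<in> ball 0 r \<Longrightarrow> cmod (q s) \<le> 4 * M / r"
proof -
  show q: "q holomorphic_on ball 0 r"
    using pole_lemma_open[OF hol open_ball, of 0] by (simp add: q_def cong: if_cong)
  fix s :: complex assume s: "s \<in> ball 0 r"
  then have r: "r > 0" by (metis ball_eq_empty empty_iff linorder_not_less)
  \<comment> \<open>The circle has to enclose \<open>s\<close>, stay inside the disc and keep away
    from 0.\<close>
  define \<rho> where "\<rho> = max (cmod s) (r / 2)"
  have \<rho>: "0 < \<rho>" "\<rho> < r" "r / 2 \<le> \<rho>" "cmod s \<le> \<rho>" using s r by (auto simp: \<rho>_def)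
  show "cmod (q s) \<le> 4 * M / r"
  proof (rule maximum_modulus_frontier[of q "cball 0 \<rho>"])
    show "q holomorphic_on interior (cball 0 \<rho>)"
      using \<rho> by (auto intro: holomorphic_on_subset[OF q])
    show "continuous_on (closure (cball 0 \<rho>)) q"
      using \<rho> by (auto intro: continuous_on_subset[OF holomorphic_on_imp_continuous_on[OF q]])
    fix t :: complex assume "t \<in> frontier (cball 0 \<rho>)"
    then have t: "cmod t = \<rho>" by simp
    have "cmod (\<phi> t - \<phi> 0) \<le> 2 * M"
      using norm_triangle_ineq4[of "\<phi> t" "\<phi> 0"] bound[of t] bound[of 0] t \<rho> by simp
    moreover have "0 \<le> M" using bound[OF s] norm_ge_zero order_trans by blast
    ultimately have "cmod (\<phi> t - \<phi> 0) / \<rho> \<le> 2 * M / (r / 2)"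
      using \<rho> r by (intro frac_le) auto
    moreover have "t \<noteq> 0" using t \<rho> by auto
    ultimately show "cmod (q t) \<le> 4 * M / r"
      using t by (simp add: q_def norm_divide)
  qed (use \<rho> in auto)
qed

text \<open>The previous bound applied to the difference quotient of \<open>q\<close> itself. The
  constant depends on \<open>M\<close> and \<open>r\<close> only, which makes the convergence to
  \<open>q 0\<close> uniform in the other variables.\<close>

lemma holomorphic_difference_quotient_lipschitz:
  fixes r :: real
  assumes hol: "\<phi> holomorphic_on ball 0 r" and bound: "\<And>s. s \<in> ball 0 r \<Longrightarrow> cmod (\<phi> s) \<le> M"
    and q_def: "q = (\<lambda>s. if s = 0 then deriv \<phi> 0 else (\<phi> s - \<phi> 0) / s)"
    and s: "s \<in> ball 0 r"
  shows "cmod (q s - q 0) \<le> 4 * (4 * M / r) / r * cmod s"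
proof (cases "s = 0")
  case False
  have "cmod ((q s - q 0) / s) \<le> 4 * (4 * M / r) / r"
    using holomorphic_difference_quotient(2)[OF holomorphic_difference_quotient[OF hol bound q_def] refl s] False
    by simp
  then show ?thesis using False by (simp add: norm_divide field_simps)
qed simp

section \<open>Separately holomorphic functions on polydiscs\<close>

definition coordinate_update :: "complex ^ 'm \<Rightarrow> 'm \<Rightarrow> complex \<Rightarrow> complex ^ 'm" where
  "coordinate_update z i s = (\<chi> j. if j = i then s else z $ j)"

lemma coordinate_update_simps [simp]:
  "coordinate_update z i s $ i = s"
  "j \<noteq> i \<Longrightarrow> coordinate_update z i s $ j = z $ j"
  "coordinate_update (coordinate_update z i s) i t = coordinate_update z i t"
  "coordinate_update z i (z $ i) = z"
  by (simp_all add: coordinate_update_def vec_eq_iff)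

lemma coordinate_update_commute:
  "i \<noteq> j \<Longrightarrow> coordinate_update (coordinate_update z i s) j t = coordinate_update (coordinate_update z j t) i s"
  by (auto simp: coordinate_update_def vec_eq_iff)

text \<open>In contrast to a ball, every coordinate may be varied over the same disc whatever the
  others are.\<close>

definition polydisc :: "real \<Rightarrow> (complex ^ 'm) set" where
  "polydisc r = {z. \<forall>i. cmod (z $ i) < r}"

lemma coordinate_update_in_polydisc:
  "z \<in> polydisc r \<Longrightarrow> s \<in> ball 0 r \<Longrightarrow> coordinate_update z i s \<in> polydisc r"
  by (simp add: polydisc_def coordinate_update_def)

definition separately_holomorphic :: "real \<Rightarrow> (complex ^ 'm \<Rightarrow> complex) \<Rightarrow> bool" where
  "separately_holomorphic r f \<longleftrightarrow>
     (\<exists>M. \<forall>z\<in>polydisc r. cmod (f z) \<le> M) \<and>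
     (\<forall>z\<in>polydisc r. \<forall>i. (\<lambda>s. f (coordinate_update z i s)) holomorphic_on ball 0 r)"

text \<open>The difference quotient is again bounded and separately holomorphic: off
  \<open>z $ i = 0\<close> this is clear, and there the quotient is a locally uniform limit. Hence no continuity
  of \<open>f\<close> in all variables together is ever used.\<close>

lemma separately_holomorphic_quotient:
  fixes f :: "complex ^ 'm \<Rightarrow> complex"
  assumes f: "separately_holomorphic r f"
  obtains g where "separately_holomorphic r g"
    and "\<And>z. f z = f (coordinate_update z i 0) + z $ i * g z"
proof -
  let ?u = coordinate_update
  obtain M where M: "\<And>z. z \<in> polydisc r \<Longrightarrow> cmod (f z) \<le> M"
    using f unfolding separately_holomorphic_def by blast
  have hol: "(\<lambda>s. f (?u z l s)) holomorphic_on ball 0 r" if "z \<in> polydisc r" for z l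
    using f that unfolding separately_holomorphic_def by blast
  define q where "q z = (\<lambda>s. if s = 0 then deriv (\<lambda>s. f (?u z i s)) 0 else (f (?u z i s) - f (?u z i 0)) / s)"
    for z
  have q_upd: "q (?u z i s) = q z" for z s by (simp add: q_def cong: if_cong)
  define g where "g z = q z (z $ i)" for z
  have bound: "cmod (f (?u z i s)) \<le> M" if "z \<in> polydisc r" "s \<in> ball 0 r" for z s
    using M coordinate_update_in_polydisc that by blast
  have q_hol: "q z holomorphic_on ball 0 r"
    and q_bound: "s \<in> ball 0 r \<Longrightarrow> cmod (q z s) \<le> 4 * M / r"
    and q_lip: "s \<in> ball 0 r \<Longrightarrow> cmod (q z s - q z 0) \<le> 4 * (4 * M / r) / r * cmod s"
    if "z \<in> polydisc r" for z s
    using holomorphic_difference_quotient[OF hol[OF that] bound[OF that] q_def]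
      holomorphic_difference_quotient_lipschitz[OF hol[OF that] bound[OF that] q_def] by blast+
  have g_hol_off: "(\<lambda>s. g (?u z l s)) holomorphic_on ball 0 r"
    if "z \<in> polydisc r" "z $ i \<noteq> 0" "l \<noteq> i" for z l
  proof -
    have r: "r > 0" using that(1) by (auto simp: polydisc_def intro: le_less_trans[OF norm_ge_zero])
    have "g (?u z l s) = (f (?u z l s) - f (?u (?u z i 0) l s)) / z $ i" for s
    proof -
      have "?u (?u z l s) i (z $ i) = ?u z l s"
        using coordinate_update_simps(4)[of "?u z l s" i] that(3) by simp
      moreover have "?u (?u z l s) i 0 = ?u (?u z i 0) l s"
        using that(3) by (rule coordinate_update_commute)
      ultimately show ?thesis using that by (simp add: g_def q_def)
    qed
    moreover have "?u z i 0 \<in> polydisc r" using that(1) r by (intro coordinate_update_in_polydisc) auto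
    ultimately show ?thesis using that by (auto intro!: holomorphic_intros hol)
  qed
  have "separately_holomorphic r g"
    unfolding separately_holomorphic_def
  proof (intro conjI exI[of _ "4 * M / r"] ballI allI)
    fix z :: "complex ^ 'm" assume z: "z \<in> polydisc r"
    then have zi: "z $ i \<in> ball 0 r" by (simp add: polydisc_def)
    then have r: "r > 0" by (metis ball_eq_empty empty_iff linorder_not_less)
    show "cmod (g z) \<le> 4 * M / r" unfolding g_def by (rule q_bound[OF z zi])
    fix l
    show "(\<lambda>s. g (?u z l s)) holomorphic_on ball 0 r"
    proof (cases "l = i")
      case True
      then show ?thesis using q_hol[OF z] by (simp add: g_def q_upd)
    next
      case li: False
      show ?thesis
      proof (cases "z $ i = 0")
        case False
        then show ?thesis using g_hol_off[OF z] li by blast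
      next
        case True
        \<comment> \<open>Nonzero points tending to 0; the shift by 2 keeps all of them strictly
          inside the disc. Replacing the vanishing coordinate by \<open>\<epsilon> n\<close> reduces
          the slice to the case already settled, up to a uniform limit.\<close>
        define \<epsilon> where "\<epsilon> n = complex_of_real (r / real (n + 2))" for n
        have norm_\<epsilon>: "cmod (\<epsilon> n) = r / real (n + 2)" for n
          using r unfolding \<epsilon>_def norm_of_real by simp
        have \<epsilon>: "\<epsilon> n \<in> ball 0 r" for n
          using r mult_strict_left_mono[of 1 "real (n + 2)" r] by (simp add: norm_\<epsilon> divide_less_eq)
        have \<epsilon>_nz: "\<epsilon> n \<noteq> 0" for n
          using norm_\<epsilon>[of n] r by auto
        have \<epsilon>0: "(\<lambda>n. cmod (\<epsilon> n)) \<longlonglongrightarrow> 0"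
          unfolding norm_\<epsilon> using LIMSEQ_ignore_initial_segment[OF lim_const_over_n[of r], of 2] by simp
        define F where "F n s = g (?u (?u z i (\<epsilon> n)) l s)" for n s
        have F_hol: "F n holomorphic_on ball 0 r" for n
          unfolding F_def using g_hol_off[OF coordinate_update_in_polydisc[OF z \<epsilon>]] \<epsilon>_nz li by simp
        let ?K = "4 * (4 * M / r) / r"
        have close: "cmod (F n s - g (?u z l s)) \<le> ?K * cmod (\<epsilon> n)" if "s \<in> ball 0 r" for n s
        proof -
          have "F n s = q (?u z l s) (\<epsilon> n)"
            using li by (simp add: F_def g_def coordinate_update_commute[of i l] q_upd)
          moreover have "g (?u z l s) = q (?u z l s) 0" using True li by (simp add: g_def)
          ultimately show ?thesis
            using q_lip[OF coordinate_update_in_polydisc[OF z that] \<epsilon>] by simp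
        qed
        have lim: "uniform_limit (ball 0 r) F (\<lambda>s. g (?u z l s)) sequentially"
        proof (rule uniform_limitI)
          fix e :: real assume "e > 0"
          have "(\<lambda>n. ?K * cmod (\<epsilon> n)) \<longlonglongrightarrow> 0" using tendsto_mult_left[OF \<epsilon>0, of ?K] by simp
          then have "\<forall>\<^sub>F n in sequentially. ?K * cmod (\<epsilon> n) < e"
            using \<open>e > 0\<close> order_tendstoD(2) by blast
          then show "\<forall>\<^sub>F n in sequentially. \<forall>s\<in>ball 0 r. dist (F n s) (g (?u z l s)) < e"
            by eventually_elim (auto simp only: dist_norm intro: le_less_trans[OF close])
        qed
        show ?thesis
        proof (rule holomorphic_uniform_sequence[OF open_ball F_hol])
          fix x :: complex assume "x \<in> ball 0 r"
          then obtain d where "d > 0" "cball x d \<subseteq> ball 0 r"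
            using open_contains_cball_eq[OF open_ball] by blast
          then show "\<exists>d>0. cball x d \<subseteq> ball 0 r \<and> uniform_limit (cball x d) F (\<lambda>s. g (?u z l s)) sequentially"
            using uniform_limit_on_subset[OF lim] by blast
        qed
      qed
    qed
  qed
  moreover have "f z = f (?u z i 0) + z $ i * g z" for z
    using coordinate_update_simps(4)[of z i] by (cases "z $ i = 0") (simp_all add: g_def q_def)
  ultimately show ?thesis using that by blast
qed

definition coordinate_projection :: "'m set \<Rightarrow> complex ^ 'm \<Rightarrow> complex ^ 'm" where
  "coordinate_projection S h = (\<chi> j. if j \<in> S then h $ j else 0)"

text \<open>Double induction on the set \<open>S\<close> of active variables and on the order
  \<open>k\<close>. In \<open>f = f(z with z_i = 0) + z_i g\<close> the first summand has one
  variable less at the same order, and the factor \<open>g\<close> needs one order less in the same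
  variables. Order 0 is boundedness. Both inductions must leave \<open>f\<close> arbitrary, since
  \<open>g\<close> takes its place.\<close>

lemma separately_holomorphic_Taylor_aux:
  fixes f :: "complex ^ 'm::finite \<Rightarrow> complex"
  assumes "finite S" "separately_holomorphic r f" "r > 0"
  shows "\<exists>q C. spanned_by_monomials (\<lambda>h j. h $ j) UNIV {\<gamma>. sum \<gamma> UNIV < k} q \<and>
           (\<forall>h\<in>polydisc r. cmod (f (coordinate_projection S h) - q h) \<le> C * norm h ^ k)"
  using assms(1,2)
proof (induction S arbitrary: k f rule: finite_induct)
  case empty
  show ?case
  proof (cases k)
    case 0
    have "coordinate_projection {} h \<in> polydisc r" for h :: "complex ^ 'm"
      using assms(3) by (simp add: coordinate_projection_def polydisc_def)
    then obtain M where "\<And>h. cmod (f (coordinate_projection {} h)) \<le> M"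
      using empty unfolding separately_holomorphic_def by blast
    then show ?thesis using 0
      by (intro exI[of _ "\<lambda>_. 0"] exI[of _ M]) (simp add: spanned_by_monomials_zero)
  next
    case (Suc k')
    have "finite {\<gamma> :: 'm \<Rightarrow> nat. sum \<gamma> UNIV < k}"
      by (rule finite_subset[OF _ finite_degree_exponents[of UNIV k]]) (auto simp: degree_exponents_def)
    then show ?thesis using Suc
      by (intro exI[of _ "\<lambda>_. f 0"] exI[of _ 0] conjI spanned_by_monomials_const)
         (auto simp: coordinate_projection_def vec_eq_iff zero_vec_def)
  qed
next
  case (insert i S)
  show ?case
    using insert.prems
  proof (induction k arbitrary: f)
    case 0
    have "coordinate_projection (insert i S) h \<in> polydisc r" if "h \<in> polydisc r" for h :: "complex ^ 'm"
      using assms(3) that by (simp add: coordinate_projection_def polydisc_def)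
    then obtain M where "\<And>h. h \<in> polydisc r \<Longrightarrow> cmod (f (coordinate_projection (insert i S) h)) \<le> M"
      using 0 unfolding separately_holomorphic_def by meson
    then show ?case
      by (intro exI[of _ "\<lambda>_. 0"] exI[of _ M]) (simp add: spanned_by_monomials_zero)
  next
    case (Suc k)
    let ?\<Gamma> = "\<lambda>k. {\<gamma> :: 'm \<Rightarrow> nat. sum \<gamma> UNIV < k}"
    let ?sp = "\<lambda>k. spanned_by_monomials (\<lambda>h j. h $ j) UNIV (?\<Gamma> k)"
    have fin: "finite (?\<Gamma> k)" for k
      by (rule finite_subset[OF _ finite_degree_exponents[of UNIV k]]) (auto simp: degree_exponents_def)
    obtain g where g: "separately_holomorphic r g"
      and fg: "\<And>z. f z = f (coordinate_update z i 0) + z $ i * g z"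
      using separately_holomorphic_quotient[OF Suc.prems] by blast
    obtain q1 C1 where q1: "?sp (Suc k) q1"
      "\<And>h. h \<in> polydisc r \<Longrightarrow> cmod (f (coordinate_projection S h) - q1 h) \<le> C1 * norm h ^ Suc k"
      using insert.IH[OF Suc.prems] by metis
    obtain q2 C2 where q2: "?sp k q2"
      "\<And>h. h \<in> polydisc r \<Longrightarrow> cmod (g (coordinate_projection (insert i S) h) - q2 h) \<le> C2 * norm h ^ k"
      using Suc.IH[OF g] by metis
    have split: "f (coordinate_projection (insert i S) h) =
        f (coordinate_projection S h) + h $ i * g (coordinate_projection (insert i S) h)" for h
    proof -
      have "coordinate_update (coordinate_projection (insert i S) h) i 0 = coordinate_projection S h"
        using insert.hyps(2) by (auto simp: coordinate_update_def coordinate_projection_def vec_eq_iff)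
      then show ?thesis
        using fg[of "coordinate_projection (insert i S) h"] by (simp add: coordinate_projection_def)
    qed
    have "?sp (Suc k) (\<lambda>h. q1 h + h $ i * q2 h)"
    proof (rule spanned_by_monomials_add[OF q1(1)], rule spanned_by_monomials_mult[OF _ q2(1) fin])
      show "spanned_by_monomials (\<lambda>h j. h $ j) UNIV {\<lambda>j. if j = i then 1 else 0} (\<lambda>h. h $ i :: complex)"
        by (rule spanned_by_monomials_var) auto
    qed (auto simp: sum.distrib)
    moreover have "cmod (f (coordinate_projection (insert i S) h) - (q1 h + h $ i * q2 h)) \<le>
        (C1 + C2) * norm h ^ Suc k" if "h \<in> polydisc r" for h
    proof -
      have "f (coordinate_projection (insert i S) h) - (q1 h + h $ i * q2 h) =
          (f (coordinate_projection S h) - q1 h) +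
          h $ i * (g (coordinate_projection (insert i S) h) - q2 h)"
        by (simp add: split algebra_simps)
      also have "cmod \<dots> \<le> C1 * norm h ^ Suc k + norm h * (C2 * norm h ^ k)"
        by (rule order_trans[OF norm_triangle_ineq] add_mono q1(2) that)+
           (auto simp: norm_mult intro!: mult_mono q2(2) that Finite_Cartesian_Product.norm_nth_le)
      finally show ?thesis by (simp add: algebra_simps)
    qed
    ultimately show ?case by blast
  qed
qed

lemma separately_holomorphic_Taylor:
  fixes f :: "complex ^ 'm::finite \<Rightarrow> complex"
  assumes "separately_holomorphic r f" "r > 0"
  obtains c C where "\<And>h. h \<in> polydisc r \<Longrightarrow>
    cmod (f h - (\<Sum>\<gamma>\<in>degree_exponents UNIV k. c \<gamma> * (\<Prod>i\<in>UNIV. h $ i ^ \<gamma> i))) \<le> C * norm h ^ (k + 1)"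
proof -
  have \<Gamma>: "{\<gamma>. sum \<gamma> UNIV < k + 1} = (degree_exponents UNIV k :: ('m \<Rightarrow> nat) set)"
    by (auto simp: degree_exponents_def)
  have proj: "coordinate_projection UNIV h = h" for h :: "complex ^ 'm"
    by (simp add: coordinate_projection_def)
  obtain q C where q: "spanned_by_monomials (\<lambda>h j. h $ j) UNIV (degree_exponents UNIV k) q"
    and C: "\<And>h. h \<in> polydisc r \<Longrightarrow> cmod (f h - q h) \<le> C * norm h ^ (k + 1)"
    using separately_holomorphic_Taylor_aux[OF finite[of UNIV] assms, of "k + 1"]
    unfolding \<Gamma> proj by blast
  obtain c where "\<And>h. q h = (\<Sum>\<gamma>\<in>degree_exponents UNIV k. c \<gamma> * (\<Prod>i\<in>UNIV. h $ i ^ \<gamma> i))"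
    using q unfolding spanned_by_monomials_def by blast
  then show ?thesis using that[of c C] C by simp
qed

lemma holomorphic_map_Taylor:
  fixes F :: "complex ^ 'm::finite \<Rightarrow> complex ^ 'k::finite"
  assumes F: "holomorphic_map_on F U" and p: "p \<in> U"
  obtains c r C where "r > 0" and
    "\<And>h. norm h < r \<Longrightarrow>
      cmod (F (p + h) $ j - (\<Sum>\<gamma>\<in>degree_exponents UNIV k. c \<gamma> * (\<Prod>i\<in>UNIV. h $ i ^ \<gamma> i))) \<le> C * norm h ^ (k + 1)"
proof -
  obtain D where D: "\<And>z. z \<in> U \<Longrightarrow> (F has_derivative D z) (at z)"
    and lin: "\<And>z. z \<in> U \<Longrightarrow> Vector_Spaces.linear (*s) (*s) (D z)"
    using F unfolding holomorphic_map_on_def by metis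
  have "open U" using F unfolding holomorphic_map_on_def by blast
  have "continuous (at p) F" using D[OF p] has_derivative_continuous by blast
  then have "eventually (\<lambda>z. dist (F z) (F p) < 1) (at p)"
    unfolding continuous_at using tendstoD zero_less_one by blast
  then obtain d where d: "d > 0" "\<And>z. dist z p < d \<Longrightarrow> dist (F z) (F p) < 1"
    unfolding eventually_at by (metis dist_self zero_less_one UNIV_I)
  obtain d' where d': "d' > 0" "ball p d' \<subseteq> U" using \<open>open U\<close> p open_contains_ball by blast
  define m where "m = min d d'"
  have m: "m > 0" using d(1) d'(1) by (simp add: m_def)
  \<comment> \<open>The norm is at most the sum of the moduli of the coordinates, so this polydisc
    lies in the ball of radius \<open>m\<close>; the added 1 makes the estimate strict.\<close>
  define r where "r = m / real (CARD('m) + 1)"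
  have r: "r > 0" using m by (simp add: r_def)
  have small: "norm h < m" if "h \<in> polydisc r" for h :: "complex ^ 'm"
  proof -
    have "norm h \<le> (\<Sum>i\<in>UNIV. cmod (h $ i))" by (simp add: norm_vec_def L2_set_le_sum)
    also have "\<dots> \<le> (\<Sum>i\<in>(UNIV::'m set). r)"
      using that by (intro sum_mono) (auto simp: polydisc_def less_imp_le)
    also have "\<dots> < m" using m by (simp add: r_def field_simps)
    finally show ?thesis .
  qed
  have "separately_holomorphic r (\<lambda>h. F (p + h) $ j)"
    unfolding separately_holomorphic_def
  proof (intro conjI exI[of _ "norm (F p) + 1"] ballI allI)
    fix z :: "complex ^ 'm" assume z: "z \<in> polydisc r"
    have "dist (F (p + z)) (F p) < 1" using d(2)[of "p + z"] small[OF z] by (simp add: dist_norm m_def)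
    then have "norm (F (p + z)) \<le> norm (F p) + 1"
      using norm_triangle_ineq2[of "F (p + z)" "F p"] by (simp add: dist_norm)
    then show "cmod (F (p + z) $ j) \<le> norm (F p) + 1"
      using Finite_Cartesian_Product.norm_nth_le order_trans by blast
    fix i
    show "(\<lambda>s. F (p + coordinate_update z i s) $ j) holomorphic_on ball 0 r"
      unfolding holomorphic_on_def
    proof
      fix s :: complex assume "s \<in> ball 0 r"
      then have "p + coordinate_update z i s \<in> U" (is "?x \<in> U")
        using small[OF coordinate_update_in_polydisc[OF z]] d'(2) by (auto simp: dist_norm m_def)
      define w where "w = coordinate_update z i 0"
      have upd: "coordinate_update z i t = w + t *s axis i 1" for t
        by (auto simp: w_def coordinate_update_def vec_eq_iff axis_def)
      have "linear (\<lambda>t::complex. t *s (axis i 1 :: complex ^ 'm))"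
        by (rule linearI) (simp_all add: vec_eq_iff algebra_simps)
      then have bl: "bounded_linear (\<lambda>t::complex. t *s (axis i 1 :: complex ^ 'm))"
        by (simp add: linear_conv_bounded_linear)
      have "((\<lambda>t. p + coordinate_update z i t) has_derivative (\<lambda>t. t *s axis i 1)) (at s)"
        unfolding upd add.assoc[symmetric]
        using has_derivative_add[OF has_derivative_const bounded_linear_imp_has_derivative[OF bl]] by simp
      from has_derivative_compose[OF this D[OF \<open>?x \<in> U\<close>]]
      have "((\<lambda>t. F (p + coordinate_update z i t)) has_derivative (\<lambda>t. D ?x (t *s axis i 1))) (at s)" .
      then have "((\<lambda>t. F (p + coordinate_update z i t) $ j) has_derivative (\<lambda>t. D ?x (t *s axis i 1) $ j)) (at s)"
        by (rule bounded_linear.has_derivative[OF bounded_linear_vec_nth])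
      \<comment> \<open>Here complex linearity of the derivative enters: the real derivative of the
        slice is multiplication by a complex number.\<close>
      moreover have "D ?x (t *s axis i 1) $ j = D ?x (axis i 1) $ j * t" for t
        using module_hom.scale[OF Vector_Spaces.linear.axioms(3)[OF lin[OF \<open>?x \<in> U\<close>]]] by simp
      ultimately have "((\<lambda>t. F (p + coordinate_update z i t) $ j) has_field_derivative D ?x (axis i 1) $ j) (at s)"
        by (simp add: has_field_derivative_def mult_commute_abs)
      then show "(\<lambda>t. F (p + coordinate_update z i t) $ j) field_differentiable at s within ball 0 r"
        using field_differentiable_at_within field_differentiable_def by blast
    qed
  qed
  then obtain c C where "\<And>h. h \<in> polydisc r \<Longrightarrow>
    cmod (F (p + h) $ j - (\<Sum>\<gamma>\<in>degree_exponents UNIV k. c \<gamma> * (\<Prod>i\<in>UNIV. h $ i ^ \<gamma> i))) \<le> C * norm h ^ (k + 1)"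
    using separately_holomorphic_Taylor[OF _ r] by blast
  moreover have "h \<in> polydisc r" if "norm h < r" for h :: "complex ^ 'm"
    using that Finite_Cartesian_Product.norm_nth_le[of h] by (auto simp: polydisc_def intro: le_less_trans)
  ultimately show ?thesis using that r by blast
qed

section \<open>Homogeneous polynomial functions\<close>

text \<open>Scaling behaviour alone would admit functions that are not polynomial. Generating the
  class from constants and linear forms keeps it free of coordinates and lets growth bounds and
  division be proved by induction. The zero function belongs to every degree.\<close>

inductive homogeneous :: "nat \<Rightarrow> ('a::euclidean_space \<Rightarrow> real) \<Rightarrow> bool" where
  const: "homogeneous 0 (\<lambda>_. c)"
| linear: "linear f \<Longrightarrow> homogeneous 1 f"
| add: "homogeneous i f \<Longrightarrow> homogeneous i g \<Longrightarrow> homogeneous i (\<lambda>h. f h + g h)"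
| mult: "homogeneous i f \<Longrightarrow> homogeneous j g \<Longrightarrow> homogeneous (i + j) (\<lambda>h. f h * g h)"

lemma homogeneous_cmult: "homogeneous i f \<Longrightarrow> homogeneous i (\<lambda>h. c * f h)"
  using homogeneous.mult[OF homogeneous.const, of i f c] by simp

lemma homogeneous_zero: "homogeneous i (\<lambda>_. 0)"
proof (induction i)
  case 0
  show ?case by (rule homogeneous.const)
next
  case (Suc i)
  have "linear (\<lambda>_::'a. 0::real)" by (rule linear_zero)
  from homogeneous.mult[OF homogeneous.linear[OF this] Suc] show ?case by simp
qed

lemma homogeneous_diff: "homogeneous i f \<Longrightarrow> homogeneous i g \<Longrightarrow> homogeneous i (\<lambda>h. f h - g h)"
  using homogeneous.add[OF _ homogeneous_cmult, of i f g "-1"] by simp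

lemma homogeneous_sum:
  "(\<And>x. x \<in> X \<Longrightarrow> homogeneous i (f x)) \<Longrightarrow> homogeneous i (\<lambda>h. \<Sum>x\<in>X. f x h)"
  by (induction X rule: infinite_finite_induct) (auto intro: homogeneous_zero homogeneous.add)

lemma homogeneous_mult': "homogeneous i f \<Longrightarrow> homogeneous j g \<Longrightarrow> m = i + j \<Longrightarrow> homogeneous m (\<lambda>h. f h * g h)"
  using homogeneous.mult by blast

lemma homogeneous_scaleR: "homogeneous i f \<Longrightarrow> f (s *\<^sub>R h) = s ^ i * f h"
  by (induction i f rule: homogeneous.induct)
     (auto simp: linear_scale algebra_simps power_add)

lemma homogeneous_0_const: "homogeneous 0 f \<Longrightarrow> f h = f 0"
  using homogeneous_scaleR[of 0 f 0 h] by simp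

lemma homogeneous_1_linear: "homogeneous (Suc 0) f \<Longrightarrow> linear f"
proof (induction "Suc 0" f rule: homogeneous.induct)
  case (mult i f j g)
  then consider "i = 0" "j = Suc 0" | "i = Suc 0" "j = 0" by linarith
  then show ?case
  proof cases
    case 1
    then have "(\<lambda>h. f h * g h) = (\<lambda>h. f 0 *\<^sub>R g h)" using homogeneous_0_const mult(1) by fastforce
    then show ?thesis using linear_compose_scale_right mult(4) 1 by metis
  next
    case 2
    then have "(\<lambda>h. f h * g h) = (\<lambda>h. g 0 *\<^sub>R f h)" using homogeneous_0_const mult(3) by fastforce
    then show ?thesis using linear_compose_scale_right mult(2) 2 by metis
  qed
qed (auto intro: linear_compose_add)

lemma homogeneous_compose_linear:
  "homogeneous i f \<Longrightarrow> linear g \<Longrightarrow> homogeneous i (\<lambda>h. f (g h))"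
  by (induction i f rule: homogeneous.induct)
     (auto intro: homogeneous.intros linear_compose[unfolded o_def] simp del: One_nat_def)

lemma homogeneous_real_polynomial_function: "homogeneous i f \<Longrightarrow> real_polynomial_function f"
  by (induction i f rule: homogeneous.induct) (auto simp: linear_conv_bounded_linear)

lemma homogeneous_continuous: "homogeneous i f \<Longrightarrow> continuous_on S f"
  using homogeneous_real_polynomial_function continuous_on_polymonial_function real_polynomial_function_eq
  by blast

lemma homogeneous_bound: "homogeneous i f \<Longrightarrow> \<exists>C\<ge>0. \<forall>h. \<bar>f h\<bar> \<le> C * norm h ^ i"
proof (induction i f rule: homogeneous.induct)
  case (const c)
  then show ?case by (intro exI[of _ "\<bar>c\<bar>"]) simp
next
  case (linear f)
  then obtain B where "B > 0" "\<And>x. norm (f x) \<le> norm x * B"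
    using bounded_linear.pos_bounded linear_conv_bounded_linear by blast
  then show ?case by (intro exI[of _ B]) (simp add: mult.commute)
next
  case (add i f g)
  then obtain C D where C: "C \<ge> 0" "\<And>h. \<bar>f h\<bar> \<le> C * norm h ^ i" and D: "D \<ge> 0" "\<And>h. \<bar>g h\<bar> \<le> D * norm h ^ i"
    by blast
  have "\<bar>f h + g h\<bar> \<le> (C + D) * norm h ^ i" for h
    using C(2)[of h] D(2)[of h] by (simp add: algebra_simps)
  then show ?case using C(1) D(1) by (intro exI[of _ "C + D"]) auto
next
  case (mult i f j g)
  then obtain C D where C: "C \<ge> 0" "\<And>h. \<bar>f h\<bar> \<le> C * norm h ^ i" and D: "D \<ge> 0" "\<And>h. \<bar>g h\<bar> \<le> D * norm h ^ j"
    by blast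
  have "\<bar>f h * g h\<bar> \<le> (C * norm h ^ i) * (D * norm h ^ j)" for h
    unfolding abs_mult using C(1) by (intro mult_mono C(2) D(2)) auto
  then show ?case using C(1) D(1)
    by (intro exI[of _ "C * D"]) (simp add: power_add mult_ac)
qed

lemma homogeneous_bigo:
  assumes "homogeneous i f" "m \<le> i"
  shows "f \<in> O[at 0](\<lambda>h. norm h ^ m)"
proof -
  obtain C where C: "C \<ge> 0" "\<And>h. \<bar>f h\<bar> \<le> C * norm h ^ i" using homogeneous_bound[OF assms(1)] by blast
  have "norm (f h) \<le> C * norm (norm h ^ m)" if "dist h 0 < 1" for h
    using that by (intro order_trans[OF C(2)[of h, folded real_norm_def]])
      (auto intro!: mult_left_mono power_decreasing C(1) assms(2))
  then show ?thesis
    by (intro bigoI[of _ C]) (auto simp: eventually_at intro!: exI[of _ 1])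
qed

text \<open>Moving from \<open>\<pi> h\<close> to \<open>h\<close> changes a linear form by a
  multiple of \<open>\<omega> h\<close>; products follow from
  \<open>f g - f' g' = (f - f') g + f' (g - g')\<close>, the primes denoting values at
  \<open>\<pi> h\<close>.\<close>

lemma homogeneous_divide:
  assumes f: "homogeneous i f" and \<omega>: "linear \<omega>" and \<pi>: "linear \<pi>"
    and split: "\<And>h. h = \<pi> h + \<omega> h *\<^sub>R w"
  shows "\<exists>q. homogeneous (i - 1) q \<and> (\<forall>h. f h = f (\<pi> h) + \<omega> h * q h)"
proof -
  \<comment> \<open>Truncated subtraction gives \<open>0 - 1 = 0\<close>, so degree 0 would spoil
    the degree of a product. Demanding a zero quotient there repairs it.\<close>
  have "\<exists>q. homogeneous (i - 1) q \<and> (i = 0 \<longrightarrow> q = (\<lambda>_. 0)) \<and> (\<forall>h. f h = f (\<pi> h) + \<omega> h * q h)"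
    using f
  proof (induction i f rule: homogeneous.induct)
    case (const c)
    then show ?case by (intro exI[of _ "\<lambda>_. 0"]) (simp add: homogeneous_zero)
  next
    case (linear f)
    have "f h = f (\<pi> h) + \<omega> h * f w" for h
      by (subst split[of h]) (simp add: linear_add[OF linear] linear_scale[OF linear])
    then have "\<forall>h. f h = f (\<pi> h) + \<omega> h * f w" ..
    moreover have "homogeneous (1 - 1) (\<lambda>_::'a. f w)" by (simp add: homogeneous.const)
    moreover have "(1::nat) = 0 \<longrightarrow> (\<lambda>_::'a. f w) = (\<lambda>_. 0)" by simp
    ultimately show ?case by (intro exI[of _ "\<lambda>_. f w"] conjI)
  next
    case (add i f g)
    then obtain q1 q2 where q1: "homogeneous (i - 1) q1" "i = 0 \<longrightarrow> q1 = (\<lambda>_. 0)" "\<And>h. f h = f (\<pi> h) + \<omega> h * q1 h"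
      and q2: "homogeneous (i - 1) q2" "i = 0 \<longrightarrow> q2 = (\<lambda>_. 0)" "\<And>h. g h = g (\<pi> h) + \<omega> h * q2 h" by blast
    have "f h + g h = f (\<pi> h) + g (\<pi> h) + \<omega> h * (q1 h + q2 h)" for h
      by (subst q1(3), subst q2(3)) (simp add: algebra_simps)
    then have "\<forall>h. f h + g h = f (\<pi> h) + g (\<pi> h) + \<omega> h * (q1 h + q2 h)" ..
    moreover have "i = 0 \<longrightarrow> (\<lambda>h. q1 h + q2 h) = (\<lambda>_. 0)" using q1(2) q2(2) by auto
    ultimately show ?case
      using homogeneous.add[OF q1(1) q2(1)] by (intro exI[of _ "\<lambda>h. q1 h + q2 h"] conjI)
  next
    case (mult i f j g)
    then obtain q1 q2 where q1: "homogeneous (i - 1) q1" "i = 0 \<longrightarrow> q1 = (\<lambda>_. 0)" "\<And>h. f h = f (\<pi> h) + \<omega> h * q1 h"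
      and q2: "homogeneous (j - 1) q2" "j = 0 \<longrightarrow> q2 = (\<lambda>_. 0)" "\<And>h. g h = g (\<pi> h) + \<omega> h * q2 h" by blast
    have 1: "homogeneous (i + j - 1) (\<lambda>h. q1 h * g h)"
      using q1(1,2) mult(2) homogeneous_zero by (cases i) (auto intro!: homogeneous_mult'[OF q1(1)] mult.hyps)
    have 2: "homogeneous (i + j - 1) (\<lambda>h. f (\<pi> h) * q2 h)"
      using q2(1,2) homogeneous_zero
      by (cases j) (auto intro!: homogeneous_mult'[OF homogeneous_compose_linear[OF mult(1) \<pi>] q2(1)])
    have "f h * g h = f (\<pi> h) * g (\<pi> h) + \<omega> h * (q1 h * g h + f (\<pi> h) * q2 h)" for h
    proof -
      have "f h * g h = f (\<pi> h) * g h + \<omega> h * q1 h * g h"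
        by (subst q1(3)) (simp add: algebra_simps)
      also have "f (\<pi> h) * g h = f (\<pi> h) * g (\<pi> h) + \<omega> h * f (\<pi> h) * q2 h"
        by (subst q2(3)) (simp add: algebra_simps)
      finally show ?thesis by (simp add: algebra_simps)
    qed
    then have "\<forall>h. f h * g h = f (\<pi> h) * g (\<pi> h) + \<omega> h * (q1 h * g h + f (\<pi> h) * q2 h)" ..
    moreover have "i + j = 0 \<longrightarrow> (\<lambda>h. q1 h * g h + f (\<pi> h) * q2 h) = (\<lambda>_. 0)" using q1(2) q2(2) by auto
    ultimately show ?case
      using homogeneous.add[OF 1 2] by (intro exI[of _ "\<lambda>h. q1 h * g h + f (\<pi> h) * q2 h"] conjI)
  qed
  then show ?thesis by blast
qed

definition homogeneous_exponents :: "'v set \<Rightarrow> nat \<Rightarrow> ('v \<Rightarrow> nat) set" where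
  "homogeneous_exponents V i = {\<gamma>. (\<forall>v. v \<notin> V \<longrightarrow> \<gamma> v = 0) \<and> sum \<gamma> V = i}"

lemma homogeneous_exponents_subset: "homogeneous_exponents V i \<subseteq> degree_exponents V i"
  by (auto simp: homogeneous_exponents_def degree_exponents_def)

lemma finite_homogeneous_exponents: "finite V \<Longrightarrow> finite (homogeneous_exponents V i)"
  by (rule finite_subset[OF homogeneous_exponents_subset finite_degree_exponents])

text \<open>Passage to coordinates, by which a homogeneous multiplier becomes finitely many real
  parameters.\<close>

lemma homogeneous_spanned_by_monomials:
  "homogeneous i f \<Longrightarrow> spanned_by_monomials (\<lambda>h b. h \<bullet> b) Basis (homogeneous_exponents Basis i) f"
proof (induction i f rule: homogeneous.induct)
  case (const c)
  show ?case
    by (rule spanned_by_monomials_const[OF finite_homogeneous_exponents[OF finite_Basis]])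
       (simp add: homogeneous_exponents_def)
next
  case (linear f)
  let ?\<Gamma> = "homogeneous_exponents Basis 1 :: ('a \<Rightarrow> nat) set"
  have "f h = (\<Sum>b\<in>Basis. f b * (h \<bullet> b))" for h
    by (subst euclidean_representation[of h, symmetric])
      (simp add: linear_sum[OF linear] linear_scale[OF linear] mult.commute)
  then have f: "f = (\<lambda>h. \<Sum>b\<in>Basis. f b * (h \<bullet> b))" by blast
  show ?case
  proof (subst f, rule spanned_by_monomials_sum)
    fix b :: 'a assume b: "b \<in> Basis"
    show "spanned_by_monomials (\<lambda>h b. h \<bullet> b) Basis ?\<Gamma> (\<lambda>h. f b * (h \<bullet> b))"
    proof (rule spanned_by_monomials_mult[where \<Gamma> = "{\<lambda>_. 0}" and \<Delta> = ?\<Gamma>])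
      show "spanned_by_monomials (\<lambda>h b. h \<bullet> b) Basis {\<lambda>_. 0} (\<lambda>_::'a. f b)"
        by (rule spanned_by_monomials_const) auto
      show "spanned_by_monomials (\<lambda>h b. h \<bullet> b) Basis ?\<Gamma> (\<lambda>h. h \<bullet> b)"
        by (rule spanned_by_monomials_var[OF finite_homogeneous_exponents[OF finite_Basis] finite_Basis b])
           (use b in \<open>auto simp: homogeneous_exponents_def\<close>)
    qed (simp_all add: finite_homogeneous_exponents)
  qed
next
  case (add i f g)
  then show ?case using spanned_by_monomials_add by blast
next
  case (mult i f j g)
  show ?case
    by (rule spanned_by_monomials_mult[OF mult.IH finite_homogeneous_exponents])
       (auto simp: homogeneous_exponents_def sum.distrib)
qed

section \<open>Jets of real polynomials along a hypersurface\<close>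

text \<open>The parts are indexed by all degrees and vanish beyond \<open>k\<close>, so that
  products are given by the Cauchy formula in every degree.\<close>

definition graded_sum :: "nat \<Rightarrow> ('a::euclidean_space \<Rightarrow> real) \<Rightarrow> bool" where
  "graded_sum k f \<longleftrightarrow>
     (\<exists>g. (\<forall>i. homogeneous i (g i)) \<and> (\<forall>i>k. \<forall>h. g i h = 0) \<and> (\<forall>h. f h = (\<Sum>i\<le>k. g i h)))"

lemma graded_sum_mono:
  assumes "graded_sum k f" "k \<le> l" shows "graded_sum l f"
proof -
  obtain g where g: "\<forall>i. homogeneous i (g i)" "\<forall>i>k. \<forall>h. g i h = 0" "\<forall>h. f h = (\<Sum>i\<le>k. g i h)"
    using assms(1) unfolding graded_sum_def by blast
  have "(\<Sum>i\<le>k. g i h) = (\<Sum>i\<le>l. g i h)" for h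
    using assms(2) g(2) by (intro sum.mono_neutral_left) auto
  then show ?thesis using g assms(2) unfolding graded_sum_def by (intro exI[of _ g]) auto
qed

lemma graded_sum_add:
  assumes "graded_sum k f" "graded_sum k g" shows "graded_sum k (\<lambda>h. f h + g h)"
proof -
  obtain a b where "\<forall>i. homogeneous i (a i)" "\<forall>i>k. \<forall>h. a i h = 0" "\<forall>h. f h = (\<Sum>i\<le>k. a i h)"
    "\<forall>i. homogeneous i (b i)" "\<forall>i>k. \<forall>h. b i h = 0" "\<forall>h. g h = (\<Sum>i\<le>k. b i h)"
    using assms unfolding graded_sum_def by metis
  then show ?thesis unfolding graded_sum_def
    by (intro exI[of _ "\<lambda>i h. a i h + b i h"]) (auto intro: homogeneous.add simp: sum.distrib)
qed

lemma graded_sum_mult: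
  assumes "graded_sum k f" "graded_sum l g" shows "graded_sum (k + l) (\<lambda>h. f h * g h)"
proof -
  obtain a b where a: "\<forall>i. homogeneous i (a i)" "\<forall>i>k. \<forall>h. a i h = 0" "\<forall>h. f h = (\<Sum>i\<le>k. a i h)"
    and b: "\<forall>i. homogeneous i (b i)" "\<forall>i>l. \<forall>h. b i h = 0" "\<forall>h. g h = (\<Sum>i\<le>l. b i h)"
    using assms unfolding graded_sum_def by metis
  have "f h * g h = (\<Sum>m\<le>k+l. \<Sum>i\<le>m. a i h * b (m - i) h)" for h
    using polynomial_product[of k "\<lambda>i. a i h" l "\<lambda>i. b i h" 1] a b by simp
  moreover have "homogeneous m (\<lambda>h. \<Sum>i\<le>m. a i h * b (m - i) h)" for m
    using a b by (intro homogeneous_sum homogeneous_mult'[of _ _ "m - _"]) auto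
  moreover have "(\<Sum>i\<le>m. a i h * b (m - i) h) = 0" if "m > k + l" for m h
  proof (intro sum.neutral ballI)
    fix i assume "i \<in> {..m}"
    then have "i > k \<or> m - i > l" using that by auto
    then show "a i h * b (m - i) h = 0" using a(2) b(2) by auto
  qed
  ultimately show ?thesis unfolding graded_sum_def
    by (intro exI[of _ "\<lambda>m h. \<Sum>i\<le>m. a i h * b (m - i) h"]) auto
qed

lemma graded_sum_const: "graded_sum k (\<lambda>_. c)"
proof -
  have "graded_sum 0 (\<lambda>_. c)" unfolding graded_sum_def
    by (intro exI[of _ "\<lambda>i _. if i = 0 then c else 0"]) (auto intro: homogeneous.const homogeneous_zero)
  then show ?thesis by (rule graded_sum_mono) simp
qed

lemma graded_sum_sum:
  assumes "\<And>x. x \<in> X \<Longrightarrow> graded_sum k (f x)"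
  shows "graded_sum k (\<lambda>h. \<Sum>x\<in>X. f x h)"
  using assms
  by (induction X rule: infinite_finite_induct) (auto intro: graded_sum_const graded_sum_add)

lemma graded_sum_power:
  assumes "graded_sum 1 f" shows "graded_sum m (\<lambda>h. f h ^ m)"
proof (induction m)
  case 0
  show ?case using graded_sum_const[of 0 1] by simp
next
  case (Suc m)
  show ?case using graded_sum_mult[OF assms Suc] by simp
qed

lemma graded_sum_prod:
  assumes "finite X" "\<And>x. x \<in> X \<Longrightarrow> graded_sum (d x) (f x)"
  shows "graded_sum (sum d X) (\<lambda>h. \<Prod>x\<in>X. f x h)"
  using assms
proof (induction X rule: finite_induct)
  case empty
  show ?case using graded_sum_const[of 0 1] by simp
next
  case (insert x X)
  then show ?case using graded_sum_mult[of "d x" "f x" "sum d X" "\<lambda>h. \<Prod>x\<in>X. f x h"] by simp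
qed

lemma graded_sum_affine_coordinate: "graded_sum 1 (\<lambda>h. (p + h) \<bullet> b)"
proof -
  have "linear (\<lambda>h. h \<bullet> b)" by (simp add: bounded_linear.linear bounded_linear_inner_left)
  then have "homogeneous i (\<lambda>h. if i = 1 then h \<bullet> b else 0)" for i
    using homogeneous.linear by (cases "i = 1") (auto simp: homogeneous_zero)
  then have "graded_sum 1 (\<lambda>h. h \<bullet> b)" unfolding graded_sum_def
    by (intro exI[of _ "\<lambda>i h. if i = 1 then h \<bullet> b else 0"]) simp
  then show ?thesis unfolding inner_add_left by (intro graded_sum_add graded_sum_const)
qed

text \<open>Expansion about \<open>p\<close> does not raise the degree, because each coordinate of
  \<open>p + h\<close> is affine in \<open>h\<close>.\<close>

lemma polynomial_fun_graded_sum: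
  assumes "P \<in> real_polynomials k"
  shows "graded_sum k (\<lambda>h. polynomial_fun P (p + h))"
  unfolding polynomial_fun_def polynomial_eval_def
proof (intro graded_sum_sum)
  fix m assume m: "m \<in> Poly_Mapping.keys P"
  have "graded_sum (0 + monomial_degree m)
      (\<lambda>h. Poly_Mapping.lookup P m * (\<Prod>v\<in>Poly_Mapping.keys m. ((p + h) \<bullet> v) ^ Poly_Mapping.lookup m v))"
    unfolding monomial_degree_def
    by (intro graded_sum_mult graded_sum_const graded_sum_prod graded_sum_power graded_sum_affine_coordinate) simp
  then show "graded_sum k
      (\<lambda>h. Poly_Mapping.lookup P m * (\<Prod>v\<in>Poly_Mapping.keys m. ((p + h) \<bullet> v) ^ Poly_Mapping.lookup m v))"
    by (rule graded_sum_mono) (use assms m in \<open>auto simp: real_polynomials_def\<close>)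
qed

section \<open>Zeros near a regular point and division of jets\<close>

lemma power_bigo_at_right: "m \<le> l \<Longrightarrow> (\<lambda>s::real. s ^ l) \<in> O[at_right 0](\<lambda>s. s ^ m)"
  by (rule bigoI[of _ 1])
     (auto simp: eventually_at_right[OF zero_less_one] power_decreasing intro!: exI[of _ 1])

text \<open>Once the lower coefficients are known to vanish, the term of degree \<open>i\<close>
  dominates the rest. The limit is one-sided because the curve to be tested is followed for positive
  times only.\<close>

lemma vanishing_power_sum:
  fixes a :: "nat \<Rightarrow> real"
  assumes "(\<lambda>s. \<Sum>i\<le>k. a i * s ^ i) \<in> O[at_right 0](\<lambda>s. s ^ (k + 1))" and "i \<le> k"
  shows "a i = 0"
  using assms(2)
proof (induction i rule: less_induct)
  case (less i)
  have "(\<Sum>l\<le>k. a l * s ^ l) - (\<Sum>l\<in>{i<..k}. a l * s ^ l) = a i * s ^ i" for s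
  proof -
    have "{..k} = {..<i} \<union> {i} \<union> {i<..k}" using less.prems by auto
    then have "(\<Sum>l\<le>k. a l * s ^ l) = (\<Sum>l\<in>{..<i} \<union> {i} \<union> {i<..k}. a l * s ^ l)" by simp
    also have "\<dots> = (\<Sum>l<i. a l * s ^ l) + a i * s ^ i + (\<Sum>l\<in>{i<..k}. a l * s ^ l)"
      by (subst sum.union_disjoint; (subst sum.union_disjoint)?) auto
    also have "(\<Sum>l<i. a l * s ^ l) = 0" using less by (intro sum.neutral) auto
    finally show ?thesis by simp
  qed
  moreover have "(\<lambda>s. (\<Sum>l\<le>k. a l * s ^ l) - (\<Sum>l\<in>{i<..k}. a l * s ^ l)) \<in> O[at_right 0](\<lambda>s. s ^ (i + 1))"
  proof (rule sum_in_bigo)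
    show "(\<lambda>s. \<Sum>l\<le>k. a l * s ^ l) \<in> O[at_right 0](\<lambda>s. s ^ (i + 1))"
      by (rule landau_o.big_trans[OF assms(1) power_bigo_at_right]) (use less.prems in simp)
    show "(\<lambda>s. \<Sum>l\<in>{i<..k}. a l * s ^ l) \<in> O[at_right 0](\<lambda>s. s ^ (i + 1))"
    proof (rule big_sum_in_bigo)
      fix l assume "l \<in> {i<..k}"
      then show "(\<lambda>s. a l * s ^ l) \<in> O[at_right 0](\<lambda>s. s ^ (i + 1))"
        using power_bigo_at_right[of "i + 1" l] by (cases "a l = 0") auto
    qed
  qed
  ultimately have "(\<lambda>s. a i * s ^ i) \<in> O[at_right 0](\<lambda>s. s ^ (i + 1))" by simp
  then obtain C where C: "\<forall>\<^sub>F s in at_right 0. norm (a i * s ^ i) \<le> C * norm (s ^ (i + 1))"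
    by (elim landau_o.bigE)
  have "\<forall>\<^sub>F s in at_right 0. \<bar>a i\<bar> \<le> C * s"
    using C eventually_at_right_less[of 0]
    by eventually_elim (simp add: abs_mult power_abs)
  moreover have "((\<lambda>s. C * s) \<longlongrightarrow> 0) (at_right 0)"
    by (rule tendsto_mult_right_zero) (rule tendsto_ident_at)
  ultimately have "\<bar>a i\<bar> \<le> 0"
    by (intro tendsto_lowerbound[of "\<lambda>s. C * s"]) auto
  then show ?case by simp
qed

text \<open>A substitute for the implicit function theorem. For small \<open>u\<close> the quadratic
  error is at most \<open>norm u\<close>, so the sign of \<open>f\<close> on the line through
  \<open>u\<close> in direction \<open>w\<close> is decided at both ends of an interval of length
  proportional to \<open>norm u\<close>. Only the linear bound on \<open>t\<close> is obtained, and
  no regularity in \<open>u\<close>.\<close>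

lemma zero_set_over_hyperplane:
  fixes f :: "'a::euclidean_space \<Rightarrow> real"
  assumes P: "\<And>i. homogeneous i (P i)" and f: "\<And>h. f h = (\<Sum>i\<le>k. P i h)"
    and P0: "\<And>h. P 0 h = 0" and w: "P 1 w \<noteq> 0" and k: "1 \<le> k"
  obtains C \<delta> where "\<delta> > 0" "\<And>u. norm u < \<delta> \<Longrightarrow> \<exists>t. \<bar>t\<bar> \<le> C * norm u \<and> f (u + t *\<^sub>R w) = 0"
proof -
  have lin: "linear (P (Suc 0))" using homogeneous_1_linear[OF P] .
  have "f h - P 1 h = (\<Sum>i\<in>{2..k}. P i h)" for h
  proof -
    have "{..k} = insert 0 (insert 1 {2..k})" using k by auto
    then show ?thesis by (simp add: f P0)
  qed
  then have "(\<lambda>h. f h - P 1 h) \<in> O[at 0](\<lambda>h. norm h ^ 2)"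
    by (simp only:) (intro big_sum_in_bigo homogeneous_bigo[OF P]; simp)
  then obtain K where K: "K > 0" "\<forall>\<^sub>F h in at 0. norm (f h - P 1 h) \<le> K * norm (norm h ^ 2)"
    by (elim landau_o.bigE)
  then obtain d where d: "d > 0" and Kd: "\<And>h. h \<noteq> 0 \<Longrightarrow> norm h < d \<Longrightarrow> \<bar>f h - P 1 h\<bar> \<le> K * norm h ^ 2"
    unfolding eventually_at by auto
  obtain B where B: "B > 0" "\<And>x. norm (P (Suc 0) x) \<le> norm x * B"
    using bounded_linear.pos_bounded lin linear_conv_bounded_linear by blast
  define c where "c = \<bar>P 1 w\<bar>"
  have c: "c > 0" using w by (simp add: c_def)
  define \<sigma> where "\<sigma> = sgn (P 1 w)"
  have \<sigma>: "\<sigma> * P 1 w = c" "\<bar>\<sigma>\<bar> = 1" using w by (auto simp: \<sigma>_def c_def sgn_if)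
  \<comment> \<open>At \<open>t = C * norm u\<close> the term \<open>t * c\<close> equals
    \<open>(B + 1) * norm u\<close>, enough to absorb both the linear part at \<open>u\<close> and
    the error \<open>norm u\<close>.\<close>
  define C where "C = (B + 1) / c"
  have C: "C > 0" using B c by (simp add: C_def)
  define A where "A = 1 + C * norm w"
  have A: "A > 0" using C by (simp add: A_def add_pos_nonneg)
  \<comment> \<open>The first bound keeps the points in the range of the estimate, as their norm is
    at most \<open>A * norm u\<close>; the second yields
    \<open>K * (A * norm u)^2 <= norm u\<close>.\<close>
  define \<delta> where "\<delta> = min (d / A) (1 / (K * A ^ 2))"
  have "\<delta> > 0" using d A K by (simp add: \<delta>_def)
  moreover have "\<exists>t. \<bar>t\<bar> \<le> C * norm u \<and> f (u + t *\<^sub>R w) = 0" if u: "norm u < \<delta>" for u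
  proof -
    define T where "T = C * norm u"
    have T: "T \<ge> 0" using C by (simp add: T_def)
    have close: "\<bar>f (u + t *\<^sub>R w) - P 1 (u + t *\<^sub>R w)\<bar> \<le> norm u" if t: "\<bar>t\<bar> \<le> T" for t
    proof (cases "u + t *\<^sub>R w = 0")
      case True
      have "f 0 = 0"
      proof -
        have "P i 0 = 0" for i
          using homogeneous_scaleR[OF P, of i 0 0] P0 by (cases i) auto
        then show ?thesis by (simp add: f)
      qed
      then show ?thesis using True linear_0[OF lin] by simp
    next
      case False
      have "norm (u + t *\<^sub>R w) \<le> norm u + \<bar>t\<bar> * norm w" using norm_triangle_ineq[of u "t *\<^sub>R w"] by simp
      also have "\<dots> \<le> norm u + T * norm w" using t by (intro add_left_mono mult_right_mono) auto
      finally have nA: "norm (u + t *\<^sub>R w) \<le> A * norm u" by (simp add: A_def T_def algebra_simps)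
      also have "A * norm u < d" using u A by (simp add: \<delta>_def field_simps)
      finally have "\<bar>f (u + t *\<^sub>R w) - P 1 (u + t *\<^sub>R w)\<bar> \<le> K * norm (u + t *\<^sub>R w) ^ 2"
        using Kd False by blast
      also have "\<dots> \<le> K * (A * norm u) ^ 2" using nA K by (intro mult_left_mono power_mono) auto
      also have "\<dots> = (K * A ^ 2 * norm u) * norm u" by (simp add: power2_eq_square)
      also have "\<dots> \<le> 1 * norm u"
        using u K A by (intro mult_right_mono) (auto simp: \<delta>_def field_simps)
      finally show ?thesis by simp
    qed
    have P1: "\<sigma> * P 1 (u + t *\<^sub>R w) = \<sigma> * P 1 u + t * c" for t
      by (simp add: linear_add[OF lin] linear_scale[OF lin] distrib_left \<sigma>(1)[symmetric])
    have \<sigma>abs: "\<bar>\<sigma> * x\<bar> = \<bar>x\<bar>" for x using \<sigma>(2) by (simp add: abs_mult)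
    have Tc: "T * c = B * norm u + norm u" using c by (simp add: T_def C_def field_simps)
    have Pu: "\<bar>\<sigma> * P 1 u\<bar> \<le> B * norm u" using B(2)[of u] by (simp add: \<sigma>abs mult.commute)
    have close': "\<bar>\<sigma> * f (u + t *\<^sub>R w) - (\<sigma> * P 1 u + t * c)\<bar> \<le> norm u" if "\<bar>t\<bar> \<le> T" for t
      using close[OF that] \<sigma>abs[of "f (u + t *\<^sub>R w) - P 1 (u + t *\<^sub>R w)"] P1[of t]
      by (simp only: right_diff_distrib)
    have "0 \<le> \<sigma> * f (u + T *\<^sub>R w)" using close'[of T] Tc Pu T by linarith
    moreover have "\<sigma> * f (u + (-T) *\<^sub>R w) \<le> 0"
      using close'[of "-T"] Tc Pu T minus_mult_left[of T c] by linarith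
    moreover have "continuous_on {-T..T} (\<lambda>t. \<sigma> * f (u + t *\<^sub>R w))"
    proof -
      have "continuous_on UNIV f"
        unfolding f by (intro continuous_on_sum homogeneous_continuous[OF P])
      moreover have "continuous_on {-T..T} (\<lambda>t. u + t *\<^sub>R w)" by (intro continuous_intros)
      ultimately have "continuous_on {-T..T} (\<lambda>t. f (u + t *\<^sub>R w))"
        by (rule continuous_on_compose2) simp
      then show ?thesis by (rule continuous_on_mult_left)
    qed
    ultimately obtain t where "-T \<le> t" "t \<le> T" "\<sigma> * f (u + t *\<^sub>R w) = 0"
      using IVT'[of "\<lambda>t. \<sigma> * f (u + t *\<^sub>R w)" "-T" 0 T] T by auto
    then show ?thesis using \<sigma>(2) by (intro exI[of _ t]) (auto simp: T_def)
  qed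
  ultimately show ?thesis using that by blast
qed

text \<open>Formal division of a power series by one with nonzero linear part, degree by degree:
  what the earlier multipliers leave in degree \<open>i\<close> is divided by
  \<open>\<omega> 1\<close>, giving the multiplier of degree \<open>i - 1\<close>. What survives
  depends on \<open>\<pi> h\<close> alone.\<close>

lemma homogeneous_division_with_remainder:
  assumes P: "\<And>i. homogeneous i (P i)" and \<omega>: "\<And>i. homogeneous i (\<omega> i)"
    and \<pi>: "linear \<pi>" and split: "\<And>h. h = \<pi> h + \<omega> 1 h *\<^sub>R w"
  shows "\<exists>b r. (\<forall>l. homogeneous l (b l)) \<and> (\<forall>l. homogeneous l (r l)) \<and>
           (\<forall>i\<le>k. \<forall>h. P i h = (\<Sum>l<i. b l h * \<omega> (i - l) h) + r i (\<pi> h))"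
proof (induction k)
  case 0
  have "P 0 h = P 0 (\<pi> h)" for h using homogeneous_0_const[OF P[of 0]] by metis
  then show ?case
    by (intro exI[of _ "\<lambda>_ _. 0"] exI[of _ P]) (auto simp: homogeneous_zero P)
next
  case (Suc k)
  then obtain b r where b: "\<And>l. homogeneous l (b l)" and r: "\<And>l. homogeneous l (r l)"
    and eq: "\<And>i h. i \<le> k \<Longrightarrow> P i h = (\<Sum>l<i. b l h * \<omega> (i - l) h) + r i (\<pi> h)" by blast
  define E where "E h = P (Suc k) h - (\<Sum>l<k. b l h * \<omega> (Suc k - l) h)" for h
  have E: "homogeneous (Suc k) E" unfolding E_def
    by (intro homogeneous_diff P homogeneous_sum homogeneous_mult'[OF b \<omega>]) auto
  have "linear (\<omega> 1)" using homogeneous_1_linear[OF \<omega>] by simp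
  then obtain q where q: "homogeneous k q" "\<And>h. E h = E (\<pi> h) + \<omega> 1 h * q h"
    using homogeneous_divide[OF E _ \<pi> split] by auto
  \<comment> \<open>Changing the multiplier of degree \<open>k\<close> leaves the identities up to
    degree \<open>k\<close> intact, since degree \<open>i\<close> involves only
    \<open>l < i\<close>.\<close>
  have "P i h = (\<Sum>l<i. (b(k := q)) l h * \<omega> (i - l) h) + (r(Suc k := E)) i (\<pi> h)" if "i \<le> Suc k" for i h
  proof (cases "i = Suc k")
    case True
    have "(\<Sum>l<Suc k. (b(k := q)) l h * \<omega> (Suc k - l) h) = (\<Sum>l<k. b l h * \<omega> (Suc k - l) h) + q h * \<omega> 1 h"
      by simp
    then show ?thesis using True q(2)[of h] unfolding E_def[of h] by (simp add: mult.commute)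
  next
    case False
    then have "i \<le> k" using that by simp
    moreover from this have "(\<Sum>l<i. (b(k := q)) l h * \<omega> (i - l) h) = (\<Sum>l<i. b l h * \<omega> (i - l) h)"
      by (intro sum.cong) auto
    ultimately show ?thesis using False eq[of i h] by simp
  qed
  then show ?case using b r q(1) E
    by (intro exI[of _ "b(k := q)"] exI[of _ "r(Suc k := E)"]) auto
qed

text \<open>The remainder vanishes because it is a function on the kernel of \<open>\<omega> 1\<close> and, at the zeros of \<open>f\<close>,
  is of order \<open>k + 1\<close>.\<close>

lemma jet_divisible:
  fixes f \<Omega> :: "'a::euclidean_space \<Rightarrow> real"
  assumes P: "\<And>i. homogeneous i (P i)" and \<omega>: "\<And>i. homogeneous i (\<omega> i)"
    and f: "\<And>h. f h = (\<Sum>i\<le>k. P i h)" and k: "1 \<le> k"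
    and \<Omega>: "(\<lambda>h. \<Omega> h - (\<Sum>i\<le>k. \<omega> i h)) \<in> O[at 0](\<lambda>h. norm h ^ (k + 1))"
    and P0: "\<And>h. P 0 h = 0" and \<omega>0: "\<And>h. \<omega> 0 h = 0"
    and P1: "P 1 a \<noteq> 0" and \<omega>1: "\<omega> 1 a' \<noteq> 0"
    and zeros: "\<forall>\<^sub>F h in nhds 0. f h = 0 \<longrightarrow> \<Omega> h = 0"
  shows "\<exists>b. (\<forall>l. homogeneous l (b l)) \<and> (\<forall>i\<le>k. \<forall>h. P i h = (\<Sum>l<i. b l h * \<omega> (i - l) h))"
proof -
  have linP: "linear (P (Suc 0))" and lin\<omega>: "linear (\<omega> (Suc 0))" using homogeneous_1_linear[OF P] homogeneous_1_linear[OF \<omega>] by simp_all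
  \<comment> \<open>A direction transversal to both kernels. If neither \<open>a\<close> nor
    \<open>a'\<close> serves, each is killed by exactly one of the two forms, and their sum by
    neither.\<close>
  obtain w0 where w0: "P 1 w0 \<noteq> 0" "\<omega> 1 w0 \<noteq> 0"
  proof (cases "\<omega> 1 a = 0 \<and> P 1 a' = 0")
    case True
    then show ?thesis using that[of "a + a'"] P1 \<omega>1 by (simp add: linear_add linP lin\<omega>)
  next
    case False
    then show ?thesis using that[of a] that[of a'] P1 \<omega>1 by blast
  qed
  define w where "w = (1 / \<omega> 1 w0) *\<^sub>R w0"
  have w: "P 1 w \<noteq> 0" "\<omega> 1 w = 1" using w0 by (simp_all add: w_def linear_scale linP lin\<omega>)
  define \<pi> where "\<pi> h = h - \<omega> 1 h *\<^sub>R w" for h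
  have \<pi>: "linear \<pi>"
    by (rule linearI) (simp_all add: \<pi>_def linear_add[OF lin\<omega>] linear_scale[OF lin\<omega>] algebra_simps)
  obtain b r where b: "\<And>l. homogeneous l (b l)" and r: "\<And>l. homogeneous l (r l)"
    and eq: "\<And>i h. i \<le> k \<Longrightarrow> P i h = (\<Sum>l<i. b l h * \<omega> (i - l) h) + r i (\<pi> h)"
  proof -
    have "h = \<pi> h + \<omega> 1 h *\<^sub>R w" for h by (simp add: \<pi>_def)
    from homogeneous_division_with_remainder[OF P \<omega> \<pi> this] show ?thesis using that by metis
  qed
  obtain C \<delta> where \<delta>: "\<delta> > 0"
    and C: "\<And>u. norm u < \<delta> \<Longrightarrow> \<exists>t. \<bar>t\<bar> \<le> C * norm u \<and> f (u + t *\<^sub>R w) = 0"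
    using zero_set_over_hyperplane[OF P f P0 w(1) k] by blast
  \<comment> \<open>An arbitrary choice of zero over \<open>u\<close>; the bound alone gives the
    growth and limit estimates below.\<close>
  define \<tau> where "\<tau> u = (SOME t. \<bar>t\<bar> \<le> C * norm u \<and> f (u + t *\<^sub>R w) = 0)" for u
  have \<tau>: "\<bar>\<tau> u\<bar> \<le> C * norm u" "f (u + \<tau> u *\<^sub>R w) = 0" if "norm u < \<delta>" for u
    using someI_ex[OF C[OF that]] by (auto simp: \<tau>_def)
  \<comment> \<open>Cutting off beyond degree \<open>k\<close> turns the product of the two jets
    into a finite Cauchy product, whose terms of degree above \<open>k\<close> are collected in
    \<open>H\<close>.\<close>
  define b' where "b' l h = (if l \<le> k then b l h else 0)" for l h
  define \<omega>' where "\<omega>' l h = (if l \<le> k then \<omega> l h else 0)" for l h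
  have b': "homogeneous l (b' l)" and \<omega>': "homogeneous l (\<omega>' l)" for l
    unfolding b'_def \<omega>'_def by (cases "l \<le> k"; simp add: b \<omega> homogeneous_zero)+
  define H where "H h = (\<Sum>m\<in>{k<..k+k}. \<Sum>l\<le>m. b' l h * \<omega>' (m - l) h)" for h
  have HO: "H \<in> O[at 0](\<lambda>h. norm h ^ (k + 1))"
    unfolding H_def by (intro big_sum_in_bigo homogeneous_bigo[OF homogeneous_mult'[OF b' \<omega>']]) auto
  define R where "R h = \<Omega> h - (\<Sum>i\<le>k. \<omega> i h)" for h
  have BO: "(\<lambda>h. (\<Sum>l\<le>k. b l h) * R h) \<in> O[at 0](\<lambda>h. norm h ^ (k + 1))"
  proof -
    have "(\<lambda>h. \<Sum>l\<le>k. b l h) \<in> O[at 0](\<lambda>h. norm h ^ 0)"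
      by (intro big_sum_in_bigo homogeneous_bigo[OF b]) simp
    from landau_o.big.mult[OF this \<Omega>[folded R_def]] show ?thesis by simp
  qed
  have A: "(\<Sum>i\<le>k. \<Sum>l<i. b l h * \<omega> (i - l) h) = (\<Sum>l\<le>k. b l h) * (\<Sum>i\<le>k. \<omega> i h) - H h" for h
  proof -
    have "(\<Sum>l\<le>k. b l h) * (\<Sum>i\<le>k. \<omega> i h) = (\<Sum>l\<le>k. b' l h) * (\<Sum>i\<le>k. \<omega>' i h)"
      by (simp add: b'_def \<omega>'_def)
    also have "\<dots> = (\<Sum>m\<le>k+k. \<Sum>l\<le>m. b' l h * \<omega>' (m - l) h)"
      using polynomial_product[of k "\<lambda>i. b' i h" k "\<lambda>i. \<omega>' i h" 1] by (simp add: b'_def \<omega>'_def)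
    also have "{..k+k} = {..k} \<union> {k<..k+k}" by auto
    also have "(\<Sum>m\<in>{..k} \<union> {k<..k+k}. \<Sum>l\<le>m. b' l h * \<omega>' (m - l) h) =
      (\<Sum>m\<le>k. \<Sum>l\<le>m. b' l h * \<omega>' (m - l) h) + H h"
      unfolding H_def by (subst sum.union_disjoint) auto
    also have "(\<Sum>m\<le>k. \<Sum>l\<le>m. b' l h * \<omega>' (m - l) h) = (\<Sum>m\<le>k. \<Sum>l<m. b l h * \<omega> (m - l) h)"
    proof (rule sum.cong[OF refl])
      fix m assume "m \<in> {..k}"
      then have "(\<Sum>l\<le>m. b' l h * \<omega>' (m - l) h) = (\<Sum>l\<le>m. b l h * \<omega> (m - l) h)"
        by (intro sum.cong) (auto simp: b'_def \<omega>'_def)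
      also have "\<dots> = (\<Sum>l<m. b l h * \<omega> (m - l) h)"
        by (simp add: lessThan_Suc_atMost[symmetric] \<omega>0)
      finally show "(\<Sum>l\<le>m. b' l h * \<omega>' (m - l) h) = (\<Sum>l<m. b l h * \<omega> (m - l) h)" .
    qed
    finally show ?thesis by simp
  qed
  have r0: "r i v = 0" if v: "\<omega> 1 v = 0" and i: "i \<le> k" for i v
  proof (cases "v = 0")
    case True
    have "r i 0 = 0"
    proof (cases i)
      case 0
      then show ?thesis using eq[of 0 0] P0 linear_0[OF \<pi>] by simp
    next
      case (Suc j)
      then show ?thesis using homogeneous_scaleR[OF r, of i 0 0] by simp
    qed
    then show ?thesis using True by simp
  next
    case False
    \<comment> \<open>A possibly discontinuous family of zeros of \<open>f\<close> lying over the
      ray through \<open>v\<close>. As \<open>v\<close> is in the kernel of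
      \<open>\<omega> 1\<close>, the projection of \<open>z s\<close> is exactly
      \<open>s *\<^sub>R v\<close>, so the remainder along it is a polynomial in
      \<open>s\<close>.\<close>
    define z where "z s = s *\<^sub>R v + \<tau> (s *\<^sub>R v) *\<^sub>R w" for s
    have \<pi>z: "\<pi> (z s) = s *\<^sub>R v" for s
      using v w(2) by (simp add: \<pi>_def z_def linear_add[OF lin\<omega>] linear_scale[OF lin\<omega>])
    define \<eta> where "\<eta> = \<delta> / norm v"
    have \<eta>: "\<eta> > 0" using False \<delta> by (simp add: \<eta>_def)
    have small: "norm (s *\<^sub>R v) < \<delta>" if "0 < s" "s < \<eta>" for s
      using that False by (simp add: \<eta>_def field_simps)
    have ev: "\<forall>\<^sub>F s in at_right 0. 0 < s \<and> s < \<eta>"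
      unfolding eventually_at_right[OF \<eta>] using \<eta> by blast
    define K where "K = norm v + \<bar>C\<bar> * norm v * norm w"
    have K: "norm (z s) \<le> K * s" if "0 < s" "s < \<eta>" for s
    proof -
      have "norm (z s) \<le> norm (s *\<^sub>R v) + \<bar>\<tau> (s *\<^sub>R v)\<bar> * norm w"
        unfolding z_def using norm_triangle_ineq by (metis norm_scaleR)
      also have "\<bar>\<tau> (s *\<^sub>R v)\<bar> \<le> \<bar>C\<bar> * norm (s *\<^sub>R v)"
        using \<tau>(1)[OF small[OF that]] abs_ge_self[of C]
        by (meson mult_right_mono norm_ge_zero order_trans)
      finally show ?thesis using that
        by (simp add: K_def algebra_simps mult_right_mono)
    qed
    have z0: "(z \<longlongrightarrow> 0) (at_right 0)"
    proof (rule tendsto_norm_zero_cancel, rule tendsto_sandwich[of "\<lambda>_. 0" _ _ "\<lambda>s. K * s"])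
      show "\<forall>\<^sub>F s in at_right 0. norm (z s) \<le> K * s" using ev by eventually_elim (use K in blast)
      show "((\<lambda>s. K * s) \<longlongrightarrow> 0) (at_right 0)"
        by (rule tendsto_mult_right_zero) (rule tendsto_ident_at)
    qed auto
    have znz: "z s \<noteq> 0" if "0 < s" for s
      using \<pi>z[of s] linear_0[OF \<pi>] that False by auto
    have zlim: "filterlim z (at 0) (at_right 0)"
      unfolding filterlim_at using z0 ev by (auto elim!: eventually_mono simp: znz)
    have zO: "(\<lambda>s. norm (z s) ^ (k + 1)) \<in> O[at_right 0](\<lambda>s. s ^ (k + 1))"
    proof (rule landau_o.big_power, rule bigoI[of _ K])
      show "\<forall>\<^sub>F s in at_right 0. norm (norm (z s)) \<le> K * norm s"
        using ev by eventually_elim (use K in simp)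
    qed
    have "(\<lambda>s. (\<Sum>l\<le>k. b l (z s)) * R (z s) + H (z s)) \<in> O[at_right 0](\<lambda>s. s ^ (k + 1))"
      by (rule landau_o.big_trans[OF _ zO], rule sum_in_bigo)
         (rule landau_o.big.compose[OF BO zlim] landau_o.big.compose[OF HO zlim])+
    \<comment> \<open>At \<open>z s\<close> both \<open>f\<close> and \<open>\<Omega>\<close>
      vanish, so the whole remainder equals what the truncations at degree \<open>k\<close>
      discard.\<close>
    moreover have "\<forall>\<^sub>F s in at_right 0. (\<Sum>l\<le>k. b l (z s)) * R (z s) + H (z s) = (\<Sum>i\<le>k. r i v * s ^ i)"
      using ev eventually_compose_filterlim[OF zeros z0]
    proof eventually_elim
      case (elim s)
      have fz: "f (z s) = 0" unfolding z_def using elim small \<tau>(2) by blast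
      then have "R (z s) = - (\<Sum>i\<le>k. \<omega> i (z s))" using elim by (simp add: R_def)
      moreover have "0 = (\<Sum>i\<le>k. \<Sum>l<i. b l (z s) * \<omega> (i - l) (z s)) + (\<Sum>i\<le>k. r i (s *\<^sub>R v))"
        using fz unfolding f by (simp add: eq sum.distrib \<pi>z)
      ultimately show ?case
        unfolding A by (simp add: homogeneous_scaleR[OF r] mult.commute)
    qed
    ultimately have "(\<lambda>s. \<Sum>i\<le>k. r i v * s ^ i) \<in> O[at_right 0](\<lambda>s. s ^ (k + 1))"
      by (subst (asm) landau_o.big.in_cong) 
    then show ?thesis by (rule vanishing_power_sum[where a = "\<lambda>i. r i v", OF _ i])
  qed
  have "\<omega> 1 (\<pi> h) = 0" for h
    using w(2) by (simp add: \<pi>_def linear_diff[OF lin\<omega>] linear_scale[OF lin\<omega>])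
  then have "P i h = (\<Sum>l<i. b l h * \<omega> (i - l) h)" if "i \<le> k" for i h
    using eq[OF that, of h] r0[OF _ that] by simp
  then show ?thesis using b by blast
qed

section \<open>Jets of transversally embedded hypersurfaces\<close>

lemma real_polynomial_function_polynomial_fun: "real_polynomial_function (polynomial_fun P)"
proof -
  have "real_polynomial_function (\<lambda>z. z \<bullet> v)" for v :: 'a
    by (rule real_polynomial_function.intros(1)) (rule bounded_linear_inner_left)
  then show ?thesis
    unfolding polynomial_fun_def polynomial_eval_def
    by (intro real_polynomial_function_sum real_polynomial_function.intros(2,4)
        real_polynomial_function_prod real_polynomial_function_power) auto
qed

lemma real_polynomial_function_C1:
  fixes f :: "'a::real_normed_vector \<Rightarrow> real"
  assumes "real_polynomial_function f"
  shows "\<exists>f'. (\<forall>x. (f has_derivative f' x) (at x)) \<and> (\<forall>v. continuous_on UNIV (\<lambda>x. f' x v))"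
  using assms
proof (induction f rule: real_polynomial_function.induct)
  case (linear f)
  then show ?case
    by (intro exI[of _ "\<lambda>_. f"]) (auto intro: bounded_linear_imp_has_derivative)
next
  case (const c)
  show ?case by (intro exI[of _ "\<lambda>_ _. 0"]) auto
next
  case (add f g)
  then obtain f' g' where "\<And>x. (f has_derivative f' x) (at x)" "\<And>v. continuous_on UNIV (\<lambda>x. f' x v)"
    "\<And>x. (g has_derivative g' x) (at x)" "\<And>v. continuous_on UNIV (\<lambda>x. g' x v)" by blast
  then show ?case
    by (intro exI[of _ "\<lambda>x v. f' x v + g' x v"] conjI allI has_derivative_add continuous_on_add)
next
  case (mult f g)
  then obtain f' g' where d: "\<And>x. (f has_derivative f' x) (at x)" "\<And>v. continuous_on UNIV (\<lambda>x. f' x v)"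
    "\<And>x. (g has_derivative g' x) (at x)" "\<And>v. continuous_on UNIV (\<lambda>x. g' x v)" by blast
  have "continuous_on UNIV f" "continuous_on UNIV g"
    using d(1,3) by (auto intro: has_derivative_continuous_on)
  then show ?case using d
    by (intro exI[of _ "\<lambda>x v. f x * g' x v + f' x v * g x"] conjI allI has_derivative_mult
        continuous_on_add continuous_on_mult)
qed

text \<open>Near a point of the hypersurface the condition on the differential is automatic, so all
  nearby zeros of the polynomial belong to the hypersurface.\<close>

lemma eventually_nonzero_frechet_derivative:
  fixes f :: "'a::real_normed_vector \<Rightarrow> real"
  assumes f: "real_polynomial_function f" and p: "frechet_derivative f (at p) \<noteq> (\<lambda>v. 0)"
  shows "\<forall>\<^sub>F z in nhds p. frechet_derivative f (at z) \<noteq> (\<lambda>v. 0)"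
proof -
  obtain f' where f': "\<And>x. (f has_derivative f' x) (at x)" and cont: "\<And>v. continuous_on UNIV (\<lambda>x. f' x v)"
    using real_polynomial_function_C1[OF f] by blast
  have fd: "frechet_derivative f (at z) = f' z" for z
    using frechet_derivative_at[OF f'] by simp
  obtain v where v: "f' p v \<noteq> 0" using p unfolding fd by blast
  have "isCont (\<lambda>x. f' x v) p" using cont[of v] by (simp add: continuous_on_eq_continuous_at)
  then have "\<forall>\<^sub>F z in nhds p. f' z v \<noteq> 0"
    using v by (simp add: isCont_def tendsto_imp_eventually_ne eventually_nhds_conv_at)
  then show ?thesis by eventually_elim (auto simp: fd)
qed

lemma second_order_imp_has_derivative_zero:
  fixes f :: "'a::real_normed_vector \<Rightarrow> real"
  assumes "(\<lambda>h. f (p + h) - f p) \<in> O[at 0](\<lambda>h. norm h ^ 2)"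
  shows "(f has_derivative (\<lambda>_. 0)) (at p)"
proof -
  obtain C where C: "\<forall>\<^sub>F h in at 0. norm (f (p + h) - f p) \<le> C * norm (norm h ^ 2)"
    using assms by (elim landau_o.bigE)
  have "((\<lambda>h. norm (f (p + h) - f p - 0) / norm h) \<longlongrightarrow> 0) (at 0)"
  proof (rule tendsto_sandwich[of "\<lambda>_. 0" _ _ "\<lambda>h. C * norm h"])
    show "\<forall>\<^sub>F h in at 0. norm (f (p + h) - f p - 0) / norm h \<le> C * norm h"
      using C by eventually_elim (auto simp: divide_le_eq power2_eq_square mult.assoc)
    show "((\<lambda>h. C * norm h) \<longlongrightarrow> 0) (at (0::'a))"
      by (rule tendsto_mult_right_zero) (rule tendsto_norm_zero, rule tendsto_ident_at)
  qed auto
  then show ?thesis unfolding has_derivative_at by simp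
qed

definition real_form :: "(('a::euclidean_space \<Rightarrow> nat) \<Rightarrow> real) \<Rightarrow> nat \<Rightarrow> 'a \<Rightarrow> real" where
  "real_form \<beta> l h = (\<Sum>\<alpha>\<in>homogeneous_exponents Basis l. \<beta> \<alpha> * (\<Prod>v\<in>Basis. (h \<bullet> v) ^ \<alpha> v))"

definition complex_form :: "(('m::finite \<Rightarrow> nat) \<Rightarrow> complex) \<Rightarrow> nat \<Rightarrow> complex ^ 'm \<Rightarrow> complex" where
  "complex_form c i h = (\<Sum>\<gamma>\<in>homogeneous_exponents UNIV i. c \<gamma> * (\<Prod>v\<in>UNIV. (h $ v) ^ \<gamma> v))"

text \<open>The part of degree \<open>i\<close> of the hyperquadric equation along the map with components
  \<open>\<Sum>\<^sub>i complex_form (c j) i\<close>. The signs of the hyperquadric become parameters \<open>\<epsilon> j\<close>, so that all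
  signatures are treated at once.\<close>

definition quadric_form ::
    "('k::finite option \<Rightarrow> ('m::finite \<Rightarrow> nat) \<Rightarrow> complex) \<Rightarrow> ('k \<Rightarrow> real) \<Rightarrow> nat \<Rightarrow> complex ^ 'm \<Rightarrow> real" where
  "quadric_form c \<epsilon> i h = Im (complex_form (c None) i h) -
     (\<Sum>j\<in>UNIV. \<epsilon> j * (\<Sum>l\<le>i. Re (complex_form (c (Some j)) l h * cnj (complex_form (c (Some j)) (i - l) h))))"

text \<open>The part of degree at most \<open>k\<close> of multiplier times quadric equation. The
  constant term of the latter is left out, being zero when the base point is mapped into the
  hyperquadric; hence multipliers of degree \<open>k\<close> never occur, and this saving is what
  the parameter count rests on.\<close>

definition jet_product ::
    "nat \<Rightarrow> ((complex ^ 'm::finite \<Rightarrow> nat) \<Rightarrow> real) \<Rightarrow> ('k::finite option \<Rightarrow> ('m \<Rightarrow> nat) \<Rightarrow> complex) \<Rightarrow>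
      ('k \<Rightarrow> real) \<Rightarrow> complex ^ 'm \<Rightarrow> real" where
  "jet_product k \<beta> c \<epsilon> h = (\<Sum>i\<le>k. \<Sum>l<i. real_form \<beta> l h * quadric_form c \<epsilon> (i - l) h)"

lemma sum_degree_exponents:
  fixes f :: "('v \<Rightarrow> nat) \<Rightarrow> 'b::comm_monoid_add"
  assumes "finite V"
  shows "(\<Sum>\<gamma>\<in>degree_exponents V k. f \<gamma>) = (\<Sum>i\<le>k. \<Sum>\<gamma>\<in>homogeneous_exponents V i. f \<gamma>)"
proof -
  have "(\<Sum>i\<le>k. \<Sum>\<gamma>\<in>{\<gamma> \<in> degree_exponents V k. sum \<gamma> V = i}. f \<gamma>) = (\<Sum>\<gamma>\<in>degree_exponents V k. f \<gamma>)"
    by (rule sum.group[OF finite_degree_exponents[OF assms]]) (auto simp: degree_exponents_def)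
  moreover have "{\<gamma> \<in> degree_exponents V k. sum \<gamma> V = i} = homogeneous_exponents V i" if "i \<le> k" for i
    using that by (auto simp: degree_exponents_def homogeneous_exponents_def)
  ultimately show ?thesis by simp
qed

text \<open>Homogeneity is meant over the reals, because the quadric equation mixes components with
  their conjugates.\<close>

definition complex_homogeneous :: "nat \<Rightarrow> ('a::euclidean_space \<Rightarrow> complex) \<Rightarrow> bool" where
  "complex_homogeneous i f \<longleftrightarrow> homogeneous i (\<lambda>h. Re (f h)) \<and> homogeneous i (\<lambda>h. Im (f h))"

lemma complex_homogeneous_mult:
  "complex_homogeneous i f \<Longrightarrow> complex_homogeneous j g \<Longrightarrow> complex_homogeneous (i + j) (\<lambda>h. f h * g h)"
  unfolding complex_homogeneous_def
  by (auto intro: homogeneous.add homogeneous_diff homogeneous.mult)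

lemma complex_homogeneous_const: "complex_homogeneous 0 (\<lambda>_. c)"
  unfolding complex_homogeneous_def by (auto intro: homogeneous.const)

lemma complex_homogeneous_sum:
  "(\<And>x. x \<in> X \<Longrightarrow> complex_homogeneous i (f x)) \<Longrightarrow> complex_homogeneous i (\<lambda>h. \<Sum>x\<in>X. f x h)"
  unfolding complex_homogeneous_def by (auto intro: homogeneous_sum)

lemma complex_homogeneous_nth: "complex_homogeneous 1 (\<lambda>h :: complex ^ 'm::finite. h $ v)"
  unfolding complex_homogeneous_def
  by (intro conjI homogeneous.linear linearI) auto

lemma complex_homogeneous_power:
  assumes "complex_homogeneous 1 f" shows "complex_homogeneous m (\<lambda>h. f h ^ m)"
proof (induction m)
  case 0
  show ?case using complex_homogeneous_const[of 1] by simp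
next
  case (Suc m)
  show ?case using complex_homogeneous_mult[OF assms Suc] by simp
qed

lemma complex_homogeneous_prod:
  assumes "finite X" "\<And>x. x \<in> X \<Longrightarrow> complex_homogeneous (d x) (f x)"
  shows "complex_homogeneous (sum d X) (\<lambda>h. \<Prod>x\<in>X. f x h)"
  using assms
proof (induction X rule: finite_induct)
  case empty
  show ?case using complex_homogeneous_const[of 1] by simp
next
  case (insert x X)
  then show ?case using complex_homogeneous_mult[of "d x" "f x" "sum d X" "\<lambda>h. \<Prod>x\<in>X. f x h"] by simp
qed

lemma complex_form_homogeneous: "complex_homogeneous i (complex_form c i)"
  unfolding complex_form_def
proof (rule complex_homogeneous_sum)
  fix \<gamma> :: "'a \<Rightarrow> nat" assume "\<gamma> \<in> homogeneous_exponents UNIV i"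
  then have "i = 0 + sum \<gamma> UNIV" by (simp add: homogeneous_exponents_def)
  then show "complex_homogeneous i (\<lambda>h. c \<gamma> * (\<Prod>v\<in>UNIV. h $ v ^ \<gamma> v))"
    by (simp only:) (intro complex_homogeneous_mult complex_homogeneous_const complex_homogeneous_prod
        complex_homogeneous_power complex_homogeneous_nth finite)
qed

lemma Re_complex_form_mult_cnj_homogeneous:
  assumes "m = i + l"
  shows "homogeneous m (\<lambda>h. Re (complex_form c i h * cnj (complex_form c l h)))"
  using complex_form_homogeneous[of i c] complex_form_homogeneous[of l c] assms
  unfolding complex_homogeneous_def by (auto intro!: homogeneous.add homogeneous.mult)

lemma quadric_form_homogeneous: "homogeneous i (quadric_form c \<epsilon> i)"
  unfolding quadric_form_def
  using complex_form_homogeneous[of i "c None"]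
  by (intro homogeneous_diff homogeneous_sum homogeneous_cmult Re_complex_form_mult_cnj_homogeneous)
     (auto simp: complex_homogeneous_def)

lemma norm_Re_mult_cnj_sum:
  "(cmod (\<Sum>i\<in>I. f i))\<^sup>2 = (\<Sum>i\<in>I. \<Sum>l\<in>I. Re (f i * cnj (f l)))"
proof -
  have "(cmod (\<Sum>i\<in>I. f i))\<^sup>2 = Re ((\<Sum>i\<in>I. f i) * cnj (\<Sum>i\<in>I. f i))"
    unfolding cmod_power2 by (simp add: power2_eq_square sum_negf)
  also have "\<dots> = (\<Sum>i\<in>I. \<Sum>l\<in>I. Re (f i * cnj (f l)))"
    unfolding cnj_sum sum_product by simp
  finally show ?thesis .
qed

text \<open>In the double sum for the squared modulus, the pairs with \<open>i + l <= k\<close> make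
  up the jet and the others have order at least \<open>k + 1\<close>.\<close>

lemma norm_square_jet:
  fixes c :: "('m::finite \<Rightarrow> nat) \<Rightarrow> complex"
  shows "(\<lambda>h. (cmod (\<Sum>i\<le>k. complex_form c i h))\<^sup>2 -
     (\<Sum>i\<le>k. \<Sum>l\<le>i. Re (complex_form c l h * cnj (complex_form c (i - l) h)))) \<in> O[at 0](\<lambda>h. norm h ^ (k + 1))"
proof -
  let ?T = "\<lambda>i l h. Re (complex_form c i h * cnj (complex_form c l h))"
  let ?D = "{(i, l). i \<le> k \<and> l \<le> k \<and> k < i + l}"
  have fin: "finite ?D" by (rule finite_subset[of _ "{..k} \<times> {..k}"]) auto
  have "(\<Sum>i\<le>k. \<Sum>l\<le>k. ?T i l h) - (\<Sum>i\<le>k. \<Sum>l\<le>i. ?T l (i - l) h) = (\<Sum>(i,l)\<in>?D. ?T i l h)" for h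
  proof -
    have "(\<Sum>i\<le>k. \<Sum>l\<le>i. ?T l (i - l) h) = (\<Sum>(i,l)\<in>{(i, l). i + l \<le> k}. ?T i l h)"
      by (rule sum.triangle_reindex_eq[symmetric])
    moreover have "(\<Sum>i\<le>k. \<Sum>l\<le>k. ?T i l h) = (\<Sum>(i,l)\<in>{..k} \<times> {..k}. ?T i l h)"
      by (rule sum.cartesian_product)
    moreover have "{..k} \<times> {..k} = {(i, l). i + l \<le> k} \<union> ?D" by auto
    moreover have "(\<Sum>(i,l)\<in>{(i, l). i + l \<le> k} \<union> ?D. ?T i l h) =
        (\<Sum>(i,l)\<in>{(i, l). i + l \<le> k}. ?T i l h) + (\<Sum>(i,l)\<in>?D. ?T i l h)"
      by (rule sum.union_disjoint[OF _ fin]) (auto intro: finite_subset[of _ "{..k} \<times> {..k}"])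
    ultimately show ?thesis by simp
  qed
  moreover have "(\<lambda>h. \<Sum>(i,l)\<in>?D. ?T i l h) \<in> O[at 0](\<lambda>h. norm h ^ (k + 1))"
  proof (rule big_sum_in_bigo)
    fix x assume "x \<in> ?D"
    then obtain i l where "x = (i, l)" "k + 1 \<le> i + l" by auto
    then show "(\<lambda>h. case x of (i, l) \<Rightarrow> ?T i l h) \<in> O[at 0](\<lambda>h. norm h ^ (k + 1))"
      by (simp only: prod.case) (rule homogeneous_bigo[OF Re_complex_form_mult_cnj_homogeneous[OF refl]])
  qed
  ultimately show ?thesis by (simp only: norm_Re_mult_cnj_sum)
qed

text \<open>Moves the signature from the index sets of the sums into coefficients, where it can
  become a parameter.\<close>

lemma hyperquadric_fun_signs:
  "hyperquadric_fun L Z = Im (Z $ None) - (\<Sum>j\<in>UNIV. (if j \<in> L then -1 else 1) * (cmod (Z $ Some j))\<^sup>2)"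
proof -
  have "(\<Sum>j\<in>UNIV. (if j \<in> L then -1 else 1) * (cmod (Z $ Some j))\<^sup>2) =
    (\<Sum>j\<in>L \<union> -L. (if j \<in> L then -1 else 1) * (cmod (Z $ Some j))\<^sup>2)" by simp
  also have "\<dots> = (\<Sum>j\<in>L. (if j \<in> L then -1 else 1) * (cmod (Z $ Some j))\<^sup>2) +
      (\<Sum>j\<in>-L. (if j \<in> L then -1 else 1) * (cmod (Z $ Some j))\<^sup>2)"
    by (rule sum.union_disjoint) auto
  finally show ?thesis by (simp add: hyperquadric_fun_def sum_negf)
qed

lemma hyperquadric_fun_has_derivative:
  "(hyperquadric_fun L has_derivative
     (\<lambda>v. Im (v $ None) - (\<Sum>j\<in>UNIV. (if j \<in> L then -1 else 1) * (2 * (q $ Some j \<bullet> v $ Some j))))) (at q)"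
proof -
  have nth: "((\<lambda>Z. Z $ j) has_derivative (\<lambda>v. v $ j)) (at q)" for j
    by (rule bounded_linear_imp_has_derivative[OF bounded_linear_vec_nth])
  have "((\<lambda>Z. Im (Z $ None) - (\<Sum>j\<in>UNIV. (if j \<in> L then -1 else 1) * (Z $ Some j \<bullet> Z $ Some j))) has_derivative
     (\<lambda>v. Im (v $ None) - (\<Sum>j\<in>UNIV. (if j \<in> L then -1 else 1) * (q $ Some j \<bullet> v $ Some j + v $ Some j \<bullet> q $ Some j)))) (at q)"
    by (intro has_derivative_diff has_derivative_Im has_derivative_sum has_derivative_mult_right
        has_derivative_inner nth)
  moreover have "hyperquadric_fun L = (\<lambda>Z. Im (Z $ None) - (\<Sum>j\<in>UNIV. (if j \<in> L then -1 else 1) * (Z $ Some j \<bullet> Z $ Some j)))"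
    by (rule ext) (simp add: hyperquadric_fun_signs power2_norm_eq_inner)
  ultimately show ?thesis by (simp add: inner_commute)
qed


section \<open>From an embedding to an identity of jets\<close>

lemma homogeneous_sum_second_order:
  assumes "\<And>i. homogeneous i (G i)" "\<And>h. G 0 h = 0" "\<And>h. G 1 h = 0"
  shows "(\<lambda>h. \<Sum>i\<le>k. G i h) \<in> O[at 0](\<lambda>h. norm h ^ 2)"
proof (rule big_sum_in_bigo)
  fix i
  show "G i \<in> O[at 0](\<lambda>h. norm h ^ 2)"
  proof (cases "i \<le> 1")
    case True
    then have "G i = (\<lambda>_. 0)" using assms(2,3) by (cases i) auto
    then show ?thesis by simp
  next
    case False
    then show ?thesis by (intro homogeneous_bigo[OF assms(1)]) simp
  qed
qed

lemma complex_form_Suc_0: "complex_form c (Suc i) 0 = 0"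
proof -
  have "Re (complex_form c (Suc i) (0 *\<^sub>R 0)) = 0 ^ Suc i * Re (complex_form c (Suc i) 0)"
    "Im (complex_form c (Suc i) (0 *\<^sub>R 0)) = 0 ^ Suc i * Im (complex_form c (Suc i) 0)"
    using complex_form_homogeneous[of "Suc i" c]
      homogeneous_scaleR[of "Suc i" "\<lambda>h. Re (complex_form c (Suc i) h)" 0 0]
      homogeneous_scaleR[of "Suc i" "\<lambda>h. Im (complex_form c (Suc i) h)" 0 0]
    unfolding complex_homogeneous_def by blast+
  then show ?thesis by (simp add: complex_eq_iff)
qed

lemma complex_jet_at_0: "(\<Sum>i\<le>k. complex_form c i 0) = complex_form c 0 0"
  by (simp add: sum.atMost_shift complex_form_Suc_0)

lemma norm_square_diff_bigo:
  fixes A B :: "'a::real_normed_vector \<Rightarrow> complex"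
  assumes AB: "(\<lambda>h. cmod (A h - B h)) \<in> O[at 0](\<lambda>h. norm h ^ m)"
    and B: "(\<lambda>h. cmod (B h)) \<in> O[at 0](\<lambda>_. 1)"
  shows "(\<lambda>h. (cmod (A h))\<^sup>2 - (cmod (B h))\<^sup>2) \<in> O[at 0](\<lambda>h. norm h ^ m)"
proof -
  have "(\<lambda>h. norm h ^ m) \<in> O[at (0::'a)](\<lambda>_. 1::real)"
    by (rule bigoI[of _ 1]) (auto simp: eventually_at power_le_one intro!: exI[of _ 1])
  then have "(\<lambda>h. cmod (A h - B h)) \<in> O[at 0](\<lambda>_. 1)" by (rule landau_o.big_trans[OF AB])
  then have "(\<lambda>h. cmod (A h - B h) + 2 * cmod (B h)) \<in> O[at 0](\<lambda>_. 1)"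
    using B by (intro sum_in_bigo) simp_all
  from landau_o.big.mult[OF AB this]
  have *: "(\<lambda>h. cmod (A h - B h) * (cmod (A h - B h) + 2 * cmod (B h))) \<in> O[at 0](\<lambda>h. norm h ^ m)" by simp
  have "\<bar>(cmod a)\<^sup>2 - (cmod b)\<^sup>2\<bar> \<le> cmod (a - b) * (cmod (a - b) + 2 * cmod b)" for a b
  proof -
    have "\<bar>(cmod a)\<^sup>2 - (cmod b)\<^sup>2\<bar> = \<bar>cmod a - cmod b\<bar> * (cmod a + cmod b)"
      by (simp add: power2_eq_square square_diff_square_factored abs_mult mult.commute)
    also have "\<dots> \<le> cmod (a - b) * (cmod (a - b) + 2 * cmod b)"
      using norm_triangle_ineq3[of a b] norm_triangle_ineq[of "a - b" b] by (intro mult_mono) auto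
    finally show ?thesis .
  qed
  then show ?thesis
    by (intro landau_o.big_trans[OF landau_o.big_mono *] always_eventually) simp
qed

lemma embeddable_imp_jet_product:
  fixes P :: "(complex ^ 'm::finite \<Rightarrow>\<^sub>0 nat) \<Rightarrow>\<^sub>0 real" and L :: "'k::finite set"
  assumes P: "P \<in> real_polynomials k" and k: "1 \<le> k"
    and emb: "transversally_embeddable (algebraic_hypersurface P) L"
  shows "\<exists>p \<beta> (c :: 'k option \<Rightarrow> _) \<epsilon>. \<forall>x. polynomial_fun P x = jet_product k \<beta> c \<epsilon> (x - p)"
proof -
  obtain p U and F :: "complex ^ 'm \<Rightarrow> complex ^ 'k option" where
    p: "p \<in> algebraic_hypersurface P" "p \<in> U" and U: "open U" and F: "holomorphic_map_on F U"
    and img: "F ` (algebraic_hypersurface P \<inter> U) \<subseteq> hyperquadric L"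
    and trans: "{u + w | u w. u \<in> hyperquadric_tangent_space L (F p) \<and>
                      w \<in> range (frechet_derivative F (at p))} = UNIV"
    using emb unfolding transversally_embeddable_def holomorphic_embedding_on_def by blast
  have Pp: "polynomial_fun P p = 0" and dP: "frechet_derivative (polynomial_fun P) (at p) \<noteq> (\<lambda>v. 0)"
    using p(1) by (auto simp: algebraic_hypersurface_def)
  define f where "f h = polynomial_fun P (p + h)" for h
  obtain G where G: "\<And>i. homogeneous i (G i)" and fG: "\<And>h. f h = (\<Sum>i\<le>k. G i h)"
    using polynomial_fun_graded_sum[OF P, of p] unfolding graded_sum_def f_def by metis
  have G0: "G 0 h = 0" for h
  proof -
    have "G (Suc i) 0 = 0" for i using homogeneous_scaleR[OF G, of "Suc i" 0 0] by simp
    then have "(\<Sum>i\<le>k. G i 0) = G 0 0"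
      by (simp add: sum.atMost_shift)
    then have "G 0 0 = 0" using fG[of 0] Pp by (simp add: f_def)
    then show ?thesis using homogeneous_0_const[OF G] by simp
  qed
  have "\<exists>a. G 1 a \<noteq> 0"
  proof (rule ccontr)
    assume "\<not> (\<exists>a. G 1 a \<noteq> 0)"
    then have "(\<lambda>h. \<Sum>i\<le>k. G i h) \<in> O[at 0](\<lambda>h. norm h ^ 2)"
      using homogeneous_sum_second_order[OF G G0] by blast
    then have "(polynomial_fun P has_derivative (\<lambda>_. 0)) (at p)"
      by (intro second_order_imp_has_derivative_zero) (simp add: fG[symmetric] f_def Pp)
    then show False using dP frechet_derivative_at by metis
  qed
  then obtain a where a: "G 1 a \<noteq> 0" by blast
  \<comment> \<open>The filter at 0 ignores the point 0 itself, so the value of the component at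
    \<open>p\<close> has to be recorded separately.\<close>
  define Q where "Q j c \<longleftrightarrow>
      (\<lambda>h. cmod (F (p + h) $ j - (\<Sum>i\<le>k. complex_form c i h))) \<in> O[at 0](\<lambda>h. norm h ^ (k + 1)) \<and>
      F p $ j = complex_form c 0 0" for j c
  have "\<exists>c. Q j c" for j
  proof -
    obtain r c C where r: "r > 0" and C: "\<And>h. norm h < r \<Longrightarrow>
      cmod (F (p + h) $ j - (\<Sum>\<gamma>\<in>degree_exponents UNIV k. c \<gamma> * (\<Prod>i\<in>UNIV. h $ i ^ \<gamma> i))) \<le> C * norm h ^ (k + 1)"
      by (rule holomorphic_map_Taylor[OF F p(2), where j = j and k = k]) blast
    then have C: "norm h < r \<Longrightarrow>
      cmod (F (p + h) $ j - (\<Sum>i\<le>k. complex_form c i h)) \<le> C * norm h ^ (k + 1)" for h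
      by (simp add: complex_form_def sum_degree_exponents)
    then have "(\<lambda>h. cmod (F (p + h) $ j - (\<Sum>i\<le>k. complex_form c i h))) \<in> O[at 0](\<lambda>h. norm h ^ (k + 1))"
      using r by (intro bigoI[of _ C]) (auto simp: eventually_at intro!: exI[of _ r])
    moreover have "F p $ j = complex_form c 0 0" using C[of 0] r by (simp add: complex_jet_at_0)
    ultimately show ?thesis unfolding Q_def by blast
  qed
  then obtain c where "\<And>j. Q j (c j)" by metis
  then have
    c: "\<And>j. (\<lambda>h. cmod (F (p + h) $ j - (\<Sum>i\<le>k. complex_form (c j) i h))) \<in> O[at 0](\<lambda>h. norm h ^ (k + 1))"
    and cp: "\<And>j. F p $ j = complex_form (c j) 0 0" unfolding Q_def by blast+
  define \<epsilon> :: "'k \<Rightarrow> real" where "\<epsilon> j = (if j \<in> L then -1 else 1)" for j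
  define \<Omega> where "\<Omega> h = hyperquadric_fun L (F (p + h))" for h
  have \<Omega>_eq: "\<Omega> h = Im (F (p + h) $ None) - (\<Sum>j\<in>UNIV. \<epsilon> j * (cmod (F (p + h) $ Some j))\<^sup>2)" for h
    by (simp add: \<Omega>_def hyperquadric_fun_signs \<epsilon>_def)
  let ?\<omega> = "quadric_form c \<epsilon>"
  let ?O = "O[at 0](\<lambda>h :: complex ^ 'm. norm h ^ (k + 1))"
  define T where "T j h = (\<Sum>i\<le>k. complex_form (c j) i h)" for j h
  define D where "D j h = (\<Sum>i\<le>k. \<Sum>l\<le>i. Re (complex_form (c (Some j)) l h * cnj (complex_form (c (Some j)) (i - l) h)))"
    for j h
  have T1: "(\<lambda>h. cmod (T j h)) \<in> O[at 0](\<lambda>_. 1)" for j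
  proof -
    let ?B = "\<lambda>h. \<Sum>i\<le>k. \<bar>Re (complex_form (c j) i h)\<bar> + \<bar>Im (complex_form (c j) i h)\<bar>"
    have "(\<lambda>h. \<bar>Re (complex_form (c j) i h)\<bar>) \<in> O[at 0](\<lambda>_. 1)"
      "(\<lambda>h. \<bar>Im (complex_form (c j) i h)\<bar>) \<in> O[at 0](\<lambda>_. 1)" for i
      using complex_form_homogeneous[of i "c j"] homogeneous_bigo[of i _ 0]
      by (auto simp: complex_homogeneous_def)
    then have "?B \<in> O[at 0](\<lambda>_. 1)" by (intro big_sum_in_bigo sum_in_bigo)
    moreover have le: "cmod (T j h) \<le> ?B h" for h
      unfolding T_def by (rule order_trans[OF norm_sum sum_mono[OF cmod_le]])
    have "norm (cmod (T j h)) \<le> norm (?B h)" for h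
      using order_trans[OF le abs_ge_self] by simp
    then have "(\<lambda>h. cmod (T j h)) \<in> O[at 0](?B)"
      by (intro landau_o.big_mono always_eventually allI)
    ultimately show ?thesis by (meson landau_o.big_trans)
  qed
  have \<Omega>: "(\<lambda>h. \<Omega> h - (\<Sum>i\<le>k. ?\<omega> i h)) \<in> ?O"
  proof -
    have "\<Omega> h - (\<Sum>i\<le>k. ?\<omega> i h) = Im (F (p + h) $ None - T None h) -
        (\<Sum>j\<in>UNIV. \<epsilon> j * (((cmod (F (p + h) $ Some j))\<^sup>2 - (cmod (T (Some j) h))\<^sup>2) +
            ((cmod (T (Some j) h))\<^sup>2 - D j h)))" for h
    proof -
      have "(\<Sum>i\<le>k. ?\<omega> i h) = Im (T None h) - (\<Sum>j\<in>UNIV. \<epsilon> j * D j h)"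
        unfolding quadric_form_def sum_subtractf T_def D_def sum_distrib_left
        by (subst (2) sum.swap) simp
      then show ?thesis
        by (simp add: \<Omega>_eq sum_subtractf algebra_simps)
    qed
    moreover have "(\<lambda>h. Im (F (p + h) $ None - T None h)) \<in> ?O"
      by (rule landau_o.big_trans[OF landau_o.big_mono c[of None, folded T_def]])
         (intro always_eventually allI, simp add: abs_Im_le_cmod del: minus_complex.simps)
    moreover have "(\<lambda>h. \<Sum>j\<in>UNIV. \<epsilon> j * (((cmod (F (p + h) $ Some j))\<^sup>2 - (cmod (T (Some j) h))\<^sup>2) +
            ((cmod (T (Some j) h))\<^sup>2 - D j h))) \<in> ?O"
    proof (rule big_sum_in_bigo)
      fix j
      have "(\<lambda>h. ((cmod (F (p + h) $ Some j))\<^sup>2 - (cmod (T (Some j) h))\<^sup>2) +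
            ((cmod (T (Some j) h))\<^sup>2 - D j h)) \<in> ?O"
        unfolding D_def
        by (rule sum_in_bigo(1), rule norm_square_diff_bigo[OF c[folded T_def] T1])
           (unfold T_def, rule norm_square_jet)
      then show "(\<lambda>h. \<epsilon> j * (((cmod (F (p + h) $ Some j))\<^sup>2 - (cmod (T (Some j) h))\<^sup>2) +
            ((cmod (T (Some j) h))\<^sup>2 - D j h))) \<in> ?O"
        by (cases "\<epsilon> j = 0") simp_all
    qed
    ultimately show ?thesis by (simp only:) (rule sum_in_bigo)
  qed
  have "F p \<in> hyperquadric L" using img p by blast
  then have \<Omega>p: "hyperquadric_fun L (F p) = 0" by (simp add: hyperquadric_def)
  have \<omega>0: "?\<omega> 0 h = 0" for h
  proof -
    have "?\<omega> 0 0 = hyperquadric_fun L (F p)"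
      unfolding hyperquadric_fun_signs cp cmod_power2
      by (simp add: quadric_form_def \<epsilon>_def power2_eq_square)
    then show ?thesis using homogeneous_0_const[OF quadric_form_homogeneous] \<Omega>p by metis
  qed
  \<comment> \<open>This is where transversality enters. If the linear part vanished, the
    differential of the quadric equation would vanish on the image of \<open>DF\<close> as well as
    on the tangent space, hence everywhere by transversality; yet it is 1 on
    \<open>axis None \<i>\<close>.\<close>
  have "\<exists>a. ?\<omega> 1 a \<noteq> 0"
  proof (rule ccontr)
    assume no: "\<not> (\<exists>a. ?\<omega> 1 a \<noteq> 0)"
    obtain DF where DF: "(F has_derivative DF) (at p)"
      using F p(2) unfolding holomorphic_map_on_def by blast
    define R where "R = (\<lambda>v. Im (v $ None) - (\<Sum>j\<in>UNIV. (if j \<in> L then -1 else 1) * (2 * (F p $ Some j \<bullet> v $ Some j))))"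
    have R: "(hyperquadric_fun L has_derivative R) (at (F p))"
      unfolding R_def by (rule hyperquadric_fun_has_derivative)
    have R_None: "R (axis None \<i>) = 1" by (simp add: R_def axis_def)
    have "(\<lambda>h. \<Sum>i\<le>k. ?\<omega> i h) \<in> O[at 0](\<lambda>h. norm h ^ 2)"
      using homogeneous_sum_second_order[OF quadric_form_homogeneous \<omega>0] no by blast
    moreover have "(\<lambda>h. \<Omega> h - (\<Sum>i\<le>k. ?\<omega> i h)) \<in> O[at 0](\<lambda>h. norm h ^ 2)"
    proof (rule landau_o.big_trans[OF \<Omega>])
      have "norm h ^ (k + 1) \<le> 1 * norm h ^ 2" if "norm h < 1" for h :: "complex ^ 'm"
        using that k power_decreasing[of 2 "k + 1" "norm h"] by simp
      then show "(\<lambda>h. norm h ^ (k + 1)) \<in> O[at (0 :: complex ^ 'm)](\<lambda>h. norm h ^ 2)"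
        by (intro bigoI[of _ 1]) (auto simp: eventually_at intro!: exI[of _ 1])
    qed
    ultimately have "\<Omega> \<in> O[at 0](\<lambda>h. norm h ^ 2)" using sum_in_bigo(1) by fastforce
    then have "((\<lambda>z. hyperquadric_fun L (F z)) has_derivative (\<lambda>_. 0)) (at p)"
      by (intro second_order_imp_has_derivative_zero) (simp add: \<Omega>_def[symmetric] \<Omega>p)
    moreover have "((\<lambda>z. hyperquadric_fun L (F z)) has_derivative (\<lambda>v. R (DF v))) (at p)"
      by (rule has_derivative_compose[OF DF R])
    ultimately have RDF: "R (DF v) = 0" for v using has_derivative_unique by metis
    have "axis None \<i> \<in> {u + w | u w. u \<in> hyperquadric_tangent_space L (F p) \<and>
                      w \<in> range (frechet_derivative F (at p))}"
      unfolding trans by simp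
    then obtain u v where uv: "axis None \<i> = u + DF v" "R u = 0"
      unfolding hyperquadric_tangent_space_def
      using frechet_derivative_at[OF DF] frechet_derivative_at[OF R] by auto
    have "R (u + DF v) = R u + R (DF v)"
      using R has_derivative_bounded_linear bounded_linear.linear linear_add by metis
    then show False using uv RDF R_None by simp
  qed
  then obtain a' where a': "?\<omega> 1 a' \<noteq> 0" by blast
  have zeros: "\<forall>\<^sub>F h in nhds 0. f h = 0 \<longrightarrow> \<Omega> h = 0"
  proof -
    have "\<forall>\<^sub>F z in nhds p. frechet_derivative (polynomial_fun P) (at z) \<noteq> (\<lambda>v. 0)"
      by (rule eventually_nonzero_frechet_derivative[OF real_polynomial_function_polynomial_fun dP])
    moreover have "\<forall>\<^sub>F z in nhds p. z \<in> U" using U p(2) eventually_nhds_in_open by blast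
    ultimately have "\<forall>\<^sub>F z in nhds p. polynomial_fun P z = 0 \<longrightarrow> hyperquadric_fun L (F z) = 0"
    proof eventually_elim
      case (elim z)
      then show ?case using img by (auto simp: algebraic_hypersurface_def hyperquadric_def)
    qed
    moreover have "((\<lambda>h. p + h) \<longlongrightarrow> p) (nhds 0)"
      using tendsto_add[OF tendsto_const[of p "nhds 0"] filterlim_ident] by simp
    ultimately show ?thesis unfolding f_def \<Omega>_def by (rule eventually_compose_filterlim)
  qed
  obtain b where b: "\<And>l. homogeneous l (b l)"
    and Gb: "\<And>i h. i \<le> k \<Longrightarrow> G i h = (\<Sum>l<i. b l h * ?\<omega> (i - l) h)"
    using jet_divisible[OF G quadric_form_homogeneous fG k \<Omega> G0 \<omega>0 a a' zeros] by blast
  have "\<exists>c. \<forall>h. b l h = (\<Sum>\<alpha>\<in>homogeneous_exponents Basis l. c \<alpha> * (\<Prod>v\<in>Basis. (h \<bullet> v) ^ \<alpha> v))" for l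
    using homogeneous_spanned_by_monomials[OF b] unfolding spanned_by_monomials_def by blast
  then obtain \<beta>0 where \<beta>0: "\<And>l h. b l h =
      (\<Sum>\<alpha>\<in>homogeneous_exponents Basis l. \<beta>0 l \<alpha> * (\<Prod>v\<in>Basis. (h \<bullet> v) ^ \<alpha> v))" by metis
  \<comment> \<open>Exponents of different degrees are distinct, so the coefficients of all the
    \<open>b l\<close> fit into one family, each exponent selecting its own degree.\<close>
  define \<beta> where "\<beta> \<alpha> = \<beta>0 (sum \<alpha> Basis) \<alpha>" for \<alpha>
  have "b l h = real_form \<beta> l h" for l h
    unfolding \<beta>0 real_form_def \<beta>_def by (intro sum.cong) (auto simp: homogeneous_exponents_def)
  then have "polynomial_fun P x = jet_product k \<beta> c \<epsilon> (x - p)" for x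
    using fG[of "x - p"] unfolding jet_product_def f_def by (simp add: Gb)
  then show ?thesis by blast
qed

section \<open>Counting parameters\<close>

text \<open>Pascal's rule: an exponent either vanishes at \<open>v\<close> or can be lowered there
  by one.\<close>

lemma card_degree_exponents:
  assumes "finite V"
  shows "card (degree_exponents V k) = (card V + k) choose card V"
  using assms
proof (induction V arbitrary: k rule: finite_induct)
  case empty
  have "degree_exponents {} k = {\<lambda>_::'a. 0}" by (auto simp: degree_exponents_def)
  then show ?case by simp
next
  case (insert v V)
  show ?case
  proof (induction k)
    case 0
    have "degree_exponents (insert v V) 0 = {\<lambda>_. 0}"
      using insert.hyps by (auto simp: degree_exponents_def fun_eq_iff) metis
    then show ?case by simp
  next
    case (Suc k)
    let ?up = "\<lambda>\<gamma>::'a \<Rightarrow> nat. \<gamma>(v := Suc (\<gamma> v))"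
    have sum_up: "(\<Sum>x\<in>V. if x = v then t else \<gamma> x) = sum \<gamma> V" for \<gamma> :: "'a \<Rightarrow> nat" and t
      using insert.hyps by (intro sum.cong) auto
    have "degree_exponents (insert v V) (Suc k) =
        degree_exponents V (Suc k) \<union> ?up ` degree_exponents (insert v V) k" (is "?L = ?A \<union> ?B")
    proof (intro equalityI subsetI)
      fix \<gamma> assume \<gamma>: "\<gamma> \<in> ?L"
      show "\<gamma> \<in> ?A \<union> ?B"
      proof (cases "\<gamma> v")
        case 0
        then have "\<gamma> w = 0" if "w \<notin> V" for w
          using \<gamma> that by (cases "w = v") (auto simp: degree_exponents_def)
        then show ?thesis using \<gamma> insert.hyps 0 by (simp add: degree_exponents_def)
      next
        case (Suc t)
        then have "\<gamma>(v := t) \<in> degree_exponents (insert v V) k"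
          using \<gamma> insert.hyps by (auto simp: degree_exponents_def sum_up)
        moreover have "\<gamma> = ?up (\<gamma>(v := t))" using Suc by (auto simp: fun_eq_iff)
        ultimately show ?thesis by blast
      qed
    next
      fix \<gamma> assume "\<gamma> \<in> ?A \<union> ?B"
      then show "\<gamma> \<in> ?L" using insert.hyps by (auto simp: degree_exponents_def sum_up)
    qed
    moreover have "?A \<inter> ?B = {}" using insert.hyps by (auto simp: degree_exponents_def)
    moreover have inj: "inj ?up"
    proof (rule injI)
      fix \<gamma> \<delta> assume eq: "?up \<gamma> = ?up \<delta>"
      show "\<gamma> = \<delta>"
      proof
        fix x show "\<gamma> x = \<delta> x" using fun_cong[OF eq, of x] by (simp split: if_splits)
      qed
    qed
    moreover have "card ?B = card (degree_exponents (insert v V) k)"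
      by (rule card_image[OF inj_on_subset[OF inj subset_UNIV]])
    moreover have "finite ?A" "finite ?B"
      using finite_degree_exponents[of V] finite_degree_exponents[of "insert v V"] insert.hyps by auto
    ultimately have "card ?L = card ?A + card (degree_exponents (insert v V) k)"
      by (simp only: card_Un_disjoint)
    then show ?case using insert.IH[of "Suc k"] Suc insert.hyps by simp
  qed
qed

text \<open>Raising \<open>p\<close> by one adds \<open>(q + p) choose (p + 1)\<close>, which is at
  least \<open>q\<close>.\<close>

lemma binomial_ge_product: "1 + q * p \<le> (q + p) choose p"
proof (induction p)
  case 0
  show ?case by simp
next
  case (Suc p)
  have "q \<le> (q + p) choose Suc p"
  proof (cases q)
    case (Suc r)
    have "r + p + 1 choose Suc p = (r + p choose p) + (r + p choose Suc p)" by simp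
    moreover have "Suc r \<le> Suc (r + p) choose Suc p"
    proof (induction r)
      case (Suc r)
      have "1 \<le> Suc r + p choose p" by (simp add: Suc_le_eq)
      then show ?case using Suc by simp
    qed simp
    ultimately show ?thesis using Suc by simp
  qed simp
  then show ?case using Suc by simp
qed

text \<open>The binomial coefficient is at least \<open>q * p\<close>, where
  \<open>p >= n + 2\<close> always and \<open>q >= 2 * N + 3\<close> for \<open>N >= 3\<close>. For
  \<open>N = 2\<close> the latter fails, 6 against 7, and the single case \<open>n = 1\<close> is
  computed.\<close>

lemma mu_bound_ge:
  assumes "1 \<le> n" "n < N"
  shows "(n + 2) * (2 * N + 3) \<le> mu_bound n N"
proof -
  define q where "q = (N + 1) * (N + 2) div 2"
  define p where "p = p_bound N n"
  have mu: "q * p \<le> mu_bound n N"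
    using binomial_ge_product[of q p] by (simp add: mu_bound_def q_def p_def)
  have "2 \<le> N choose n"
  proof -
    have "Suc n choose n \<le> N choose n" using assms(2) by (intro binomial_right_mono) simp
    then show ?thesis using assms(1) by simp
  qed
  moreover have "1 \<le> n * (n + 1) div 2" using assms(1) mult_le_mono[of 1 n 2 "n + 1"] by simp
  ultimately have "1 * 2 \<le> (n * (n + 1) div 2) * (N choose n)" by (intro mult_le_mono)
  then have p: "n + 2 \<le> p" by (simp add: p_def p_bound_def)
  show ?thesis
  proof (cases "N = 2")
    case True
    then have "n = 1" using assms by simp
    then have "q = 6" "p = 3" using True by (simp_all add: q_def p_def p_bound_def)
    moreover have "(9 :: nat) choose 3 = 84" by (simp add: eval_nat_numeral)
    ultimately show ?thesis using True \<open>n = 1\<close> by (simp add: mu_bound_def q_def p_def)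
  next
    case False
    then have "3 \<le> N" using assms by simp
    then have "3 * N \<le> N * N" by simp
    moreover have "(N + 1) * (N + 2) = N * N + 3 * N + 2" by (simp add: algebra_simps)
    moreover have "(2 * N + 3) * 2 = 4 * N + 6" by simp
    ultimately have "(2 * N + 3) * 2 \<le> (N + 1) * (N + 2)" using \<open>3 \<le> N\<close> by presburger
    then have "2 * N + 3 \<le> q" unfolding q_def by (simp add: less_eq_div_iff_mult_less_eq)
    then have "(2 * N + 3) * (n + 2) \<le> q * p" using p by (rule mult_le_mono)
    then show ?thesis using mu by (simp add: mult.commute)
  qed
qed

text \<open>The summands count base point, multiplier, real coefficients of the map, and signs. By
  Pascal's rule the multiplier leaves \<open>(2n+1+k) choose (2n+1)\<close>, which for n >= 1 is at
  least \<open>(n+2+k) choose (n+2)\<close>, that is \<open>(n+2+k) / (n+2)\<close> times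
  \<open>G\<close>. The factor reaches \<open>2N + 4\<close> exactly when k >= (n+2)(2N+3); then
  \<open>2 (N+1) G\<close> pays for the map and the spare \<open>2 G\<close> for point and
  signs.\<close>

lemma parameter_count_less:
  assumes n: "1 \<le> n" and nN: "n < N" and k: "mu_bound n N \<le> k"
  shows "2 * n + 2 + ((2 * n + 2 + (k - 1)) choose (2 * n + 2)) +
           (N + 1) * (((n + 1 + k) choose (n + 1)) * 2) + N < (2 * n + 2 + k) choose (2 * n + 2)"
proof -
  define G where "G = (n + 1 + k) choose (n + 1)"
  have k': "(n + 2) * (2 * N + 3) \<le> k" using mu_bound_ge[OF n nN] k by linarith
  have "2 * N + 3 \<le> (n + 2) * (2 * N + 3)" by simp
  then have kN: "2 * N + 3 \<le> k" using k' by (rule le_trans)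
  have "1 + k * (n + 1) \<le> G"
    using binomial_ge_product[of k "n + 1"] by (simp add: G_def add.commute)
  moreover have "k * 1 \<le> k * (n + 1)" by (rule mult_le_mono) auto
  ultimately have G: "2 * n + 2 + N < 2 * G" using kN nN by linarith
  have mono: "(n + 2 + k) choose (n + 2) \<le> (n + 2 + j + k) choose (n + 2 + j)" for j
    by (induction j) auto
  have "n + 2 + (n - 1) = 2 * n + 1" using n by simp
  then have le: "(n + 2 + k) choose (n + 2) \<le> (2 * n + 1 + k) choose (2 * n + 1)"
    using mono[of "n - 1"] by (simp only:)
  have "(n + 2) * ((n + 2 + k) choose (n + 2)) = (n + 2 + k) * G"
    using Suc_times_binomial[of "n + 1" "n + 1 + k"] by (simp add: G_def)
  also have "(n + 2) * (2 * N + 4) * G \<le> (n + 2 + k) * G" using k' by (intro mult_le_mono1) (simp add: algebra_simps)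
  finally have "(n + 2) * ((2 * N + 4) * G) \<le> (n + 2) * ((n + 2 + k) choose (n + 2))"
    by (simp only: mult.assoc)
  then have "(2 * N + 4) * G \<le> (n + 2 + k) choose (n + 2)" by (simp only: mult_le_cancel1)
  moreover have "(N + 1) * (G * 2) + 2 * G = (2 * N + 4) * G" by (simp add: algebra_simps)
  ultimately have "2 * n + 2 + (N + 1) * (G * 2) + N < (2 * n + 1 + k) choose (2 * n + 1)"
    using G le by linarith
  moreover obtain j where "k = Suc j" using kN by (cases k) auto
  ultimately show ?thesis by (simp add: G_def)
qed

section \<open>Non-embeddability of generic hypersurfaces\<close>

text \<open>Exchanges summation over the support for summation over a fixed box of exponents, the
  form in which interpolation weights apply.\<close>

lemma polynomial_eval_cube:
  fixes P :: "('v \<Rightarrow>\<^sub>0 nat) \<Rightarrow>\<^sub>0 real"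
  assumes V: "finite V" and P: "\<And>m. m \<in> Poly_Mapping.keys P \<Longrightarrow> Poly_Mapping.lookup m \<in> cube_exponents V e"
  shows "polynomial_eval P x =
    (\<Sum>\<gamma>\<in>cube_exponents V e. Poly_Mapping.lookup P (Abs_poly_mapping \<gamma>) * (\<Prod>v\<in>V. x v ^ \<gamma> v))"
proof -
  let ?t = "\<lambda>\<gamma>. Poly_Mapping.lookup P (Abs_poly_mapping \<gamma>) * (\<Prod>v\<in>V. x v ^ \<gamma> v)"
  have keys: "Poly_Mapping.keys m \<subseteq> V" if "m \<in> Poly_Mapping.keys P" for m
    using P[OF that] by (auto simp: cube_exponents_def in_keys_iff)
  have "polynomial_eval P x = (\<Sum>m\<in>Poly_Mapping.keys P. ?t (Poly_Mapping.lookup m))"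
    unfolding polynomial_eval_def
  proof (intro sum.cong refl arg_cong2[of _ _ _ _ "(*)"])
    fix m assume "m \<in> Poly_Mapping.keys P"
    then show "(\<Prod>v\<in>Poly_Mapping.keys m. x v ^ Poly_Mapping.lookup m v) = (\<Prod>v\<in>V. x v ^ Poly_Mapping.lookup m v)"
      using V keys by (intro prod.mono_neutral_left) (auto simp: in_keys_iff)
  qed (simp add: Poly_Mapping.lookup_inverse)
  also have "\<dots> = (\<Sum>\<gamma>\<in>Poly_Mapping.lookup ` Poly_Mapping.keys P. ?t \<gamma>)"
    by (simp add: sum.reindex inj_on_def Poly_Mapping.lookup_inject)
  also have "\<dots> = (\<Sum>\<gamma>\<in>cube_exponents V e. ?t \<gamma>)"
  proof (rule sum.mono_neutral_left)
    show "Poly_Mapping.lookup ` Poly_Mapping.keys P \<subseteq> cube_exponents V e" using P by blast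
    show "\<forall>\<gamma>\<in>cube_exponents V e - Poly_Mapping.lookup ` Poly_Mapping.keys P. ?t \<gamma> = 0"
    proof
      fix \<gamma> assume \<gamma>: "\<gamma> \<in> cube_exponents V e - Poly_Mapping.lookup ` Poly_Mapping.keys P"
      then have "finite {v. \<gamma> v \<noteq> 0}"
        by (intro finite_subset[OF _ V]) (auto simp: cube_exponents_def)
      then have "Poly_Mapping.lookup (Abs_poly_mapping \<gamma>) = \<gamma>" by simp
      then have "Abs_poly_mapping \<gamma> \<notin> Poly_Mapping.keys P" using \<gamma> by force
      then show "?t \<gamma> = 0" by (simp add: in_keys_iff)
    qed
  qed (rule finite_cube_exponents[OF V])
  finally show ?thesis .
qed

text \<open>These monomials index the linear coordinates on the space of polynomials; their number
  is its dimension.\<close>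

definition basis_monomials :: "nat \<Rightarrow> ('a::euclidean_space \<Rightarrow>\<^sub>0 nat) set" where
  "basis_monomials k = {m. Poly_Mapping.keys m \<subseteq> Basis \<and> monomial_degree m \<le> k}"

lemma basis_monomials_bij:
  "bij_betw Poly_Mapping.lookup (basis_monomials k) (degree_exponents (Basis :: 'a::euclidean_space set) k)"
proof (rule bij_betw_byWitness[where f' = Abs_poly_mapping])
  have deg: "monomial_degree m = sum (Poly_Mapping.lookup m) Basis" if "Poly_Mapping.keys m \<subseteq> Basis"
    for m :: "'a \<Rightarrow>\<^sub>0 nat"
    unfolding monomial_degree_def using that by (intro sum.mono_neutral_left) (auto simp: in_keys_iff)
  have lookup: "Poly_Mapping.lookup (Abs_poly_mapping \<gamma>) = \<gamma>" if "\<gamma> \<in> degree_exponents Basis k" for \<gamma> :: "'a \<Rightarrow> nat"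
    using that by (intro lookup_Abs_poly_mapping finite_subset[OF _ finite_Basis]) (auto simp: degree_exponents_def)
  show "\<forall>m\<in>basis_monomials k. Abs_poly_mapping (Poly_Mapping.lookup m) = m"
    by (simp add: Poly_Mapping.lookup_inverse)
  show "\<forall>\<gamma>\<in>degree_exponents (Basis :: 'a set) k. Poly_Mapping.lookup (Abs_poly_mapping \<gamma>) = \<gamma>"
    using lookup by blast
  show "Poly_Mapping.lookup ` basis_monomials k \<subseteq> degree_exponents (Basis :: 'a set) k"
    using deg by (auto simp: basis_monomials_def degree_exponents_def in_keys_iff)
  show "Abs_poly_mapping ` degree_exponents (Basis :: 'a set) k \<subseteq> basis_monomials k"
  proof
    fix m assume "m \<in> Abs_poly_mapping ` degree_exponents (Basis :: 'a set) k"
    then obtain \<gamma> where \<gamma>: "\<gamma> \<in> degree_exponents (Basis :: 'a set) k" "m = Abs_poly_mapping \<gamma>" by blast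
    have "Poly_Mapping.keys m \<subseteq> Basis"
    proof
      fix x assume "x \<in> Poly_Mapping.keys m"
      then have "\<gamma> x \<noteq> 0" using lookup[OF \<gamma>(1)] \<gamma>(2) by (simp add: in_keys_iff)
      then show "x \<in> Basis" using \<gamma>(1) by (metis (mono_tags, lifting) degree_exponents_def mem_Collect_eq)
    qed
    then show "m \<in> basis_monomials k"
      using deg[of m] lookup \<gamma> by (auto simp: basis_monomials_def degree_exponents_def)
  qed
qed

definition grid_point :: "('a::euclidean_space \<Rightarrow> nat) \<Rightarrow> 'a" where
  "grid_point J = (\<Sum>b\<in>Basis. real (J b) *\<^sub>R b)"

text \<open>The jet identity gives \<open>P\<close> only as a function. Expressing coefficients
  linearly through finitely many values makes them polynomial in the parameters as soon as the
  values are.\<close>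

lemma coefficients_from_grid_values:
  obtains W :: "('a::euclidean_space \<Rightarrow>\<^sub>0 nat) \<Rightarrow> ('a \<Rightarrow> nat) \<Rightarrow> real"
  where "\<And>P m. P \<in> real_polynomials k \<Longrightarrow> m \<in> basis_monomials k \<Longrightarrow>
    Poly_Mapping.lookup P m = (\<Sum>J\<in>cube_exponents Basis k. W m J * polynomial_fun P (grid_point J))"
proof -
  let ?C = "cube_exponents (Basis :: 'a set) k"
  obtain W :: "('a \<Rightarrow> nat) \<Rightarrow> ('a \<Rightarrow> nat) \<Rightarrow> real" where W: "\<And>c \<alpha>. \<alpha> \<in> ?C \<Longrightarrow>
    (\<Sum>J\<in>?C. W \<alpha> J * (\<Sum>\<gamma>\<in>?C. c \<gamma> * (\<Prod>v\<in>Basis. real (J v) ^ \<gamma> v))) = c \<alpha>"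
    by (rule grid_coefficient_weights[OF finite_Basis]) blast
  have cube: "Poly_Mapping.lookup m \<in> ?C" if "m \<in> basis_monomials k" for m
    using basis_monomials_bij[of k] degree_exponents_subset_cube[OF finite_Basis] that
    by (auto simp: bij_betw_def)
  have "Poly_Mapping.lookup P m = (\<Sum>J\<in>?C. W (Poly_Mapping.lookup m) J * polynomial_fun P (grid_point J))"
    if P: "P \<in> real_polynomials k" and m: "m \<in> basis_monomials k" for P m
  proof -
    have "polynomial_fun P (grid_point J) =
      (\<Sum>\<gamma>\<in>?C. Poly_Mapping.lookup P (Abs_poly_mapping \<gamma>) * (\<Prod>v\<in>Basis. real (J v) ^ \<gamma> v))" for J
      unfolding polynomial_fun_def
      by (subst polynomial_eval_cube[OF finite_Basis cube])
         (use P in \<open>auto simp: real_polynomials_def basis_monomials_def grid_point_def inner_sum_left_Basis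
            intro!: sum.cong prod.cong\<close>)
    then show ?thesis using W[OF cube[OF m]] by (simp add: Poly_Mapping.lookup_inverse)
  qed
  then show ?thesis by (intro that[of "\<lambda>m. W (Poly_Mapping.lookup m)"])
qed

text \<open>All kinds of parameters share one type, so that they form a single set of variables. The
  flag of \<open>Component\<close> distinguishes real from imaginary part.\<close>

datatype ('a, 'm, 'k) parameter =
  Base_point 'a | Multiplier "'a \<Rightarrow> nat" | Component "'k option" "'m \<Rightarrow> nat" bool | Sign 'k

definition parameters :: "nat \<Rightarrow> (complex ^ 'm::finite, 'm, 'k::finite) parameter set" where
  "parameters k = Base_point ` Basis \<union> Multiplier ` degree_exponents Basis (k - 1) \<union>
     (\<lambda>(j, \<gamma>, r). Component j \<gamma> r) ` (UNIV \<times> degree_exponents UNIV k \<times> UNIV) \<union> Sign ` UNIV"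

lemma finite_parameters: "finite (parameters k)"
  unfolding parameters_def by (intro finite_UnI finite_imageI finite_cartesian_product finite_degree_exponents) auto

lemma card_parameters_less:
  assumes "1 \<le> n" "n < N" "CARD('m::finite) = n + 1" "CARD('k::finite) = N" "mu_bound n N \<le> k"
  shows "card (parameters k :: (complex ^ 'm, 'm, 'k) parameter set) <
    card (basis_monomials k :: (complex ^ 'm \<Rightarrow>\<^sub>0 nat) set)"
proof -
  let ?B = "Basis :: (complex ^ 'm) set" and ?E = "degree_exponents (UNIV :: 'm set) k"
  have B: "card ?B = 2 * n + 2" using assms(3) by simp
  have "card (parameters k :: (complex ^ 'm, 'm, 'k) parameter set) \<le>
      card ?B + card (degree_exponents ?B (k - 1)) +
      card ((UNIV :: 'k option set) \<times> ?E \<times> (UNIV :: bool set)) + card (UNIV :: 'k set)"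
    unfolding parameters_def
    by (intro order_trans[OF card_Un_le] add_mono card_image_le finite_cartesian_product
        finite_degree_exponents finite_Basis finite)
  also have "\<dots> = 2 * n + 2 + ((2 * n + 2 + (k - 1)) choose (2 * n + 2)) +
           (N + 1) * (((n + 1 + k) choose (n + 1)) * 2) + N"
    by (simp only: card_degree_exponents[OF finite_Basis] card_degree_exponents[OF finite] B assms(3,4)
        card_cartesian_product card_UNIV_option card_UNIV_bool) (use assms(2,4) in simp)
  also have "\<dots> < (2 * n + 2 + k) choose (2 * n + 2)"
    by (rule parameter_count_less[OF assms(1,2,5)])
  also have "\<dots> = card (basis_monomials k :: (complex ^ 'm \<Rightarrow>\<^sub>0 nat) set)"
    using bij_betw_same_card[OF basis_monomials_bij[of k, where 'a = "complex ^ 'm"]]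
    by (simp only: card_degree_exponents[OF finite_Basis] B)
  finally show ?thesis .
qed

section \<open>Polynomial dependence on the parameters\<close>

definition complex_polynomial_in :: "'v set \<Rightarrow> (('v \<Rightarrow> real) \<Rightarrow> complex) \<Rightarrow> bool" where
  "complex_polynomial_in V f \<longleftrightarrow> polynomial_in V (\<lambda>y. Re (f y)) \<and> polynomial_in V (\<lambda>y. Im (f y))"

lemma complex_polynomial_in_const: "finite V \<Longrightarrow> complex_polynomial_in V (\<lambda>_. c)"
  by (simp add: complex_polynomial_in_def polynomial_in_const)

lemma complex_polynomial_in_cnj:
  "complex_polynomial_in V f \<Longrightarrow> complex_polynomial_in V (\<lambda>y. cnj (f y))"
  unfolding complex_polynomial_in_def
  using polynomial_in_diff[OF polynomial_in_const[of V 0], of "\<lambda>y. Im (f y)"]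
  by (auto simp: polynomial_in_def)

lemma complex_polynomial_in_mult:
  "complex_polynomial_in V f \<Longrightarrow> complex_polynomial_in V g \<Longrightarrow> complex_polynomial_in V (\<lambda>y. f y * g y)"
  by (simp add: complex_polynomial_in_def polynomial_in_add polynomial_in_diff polynomial_in_mult)

lemma complex_polynomial_in_sum:
  "finite V \<Longrightarrow> (\<And>i. i \<in> I \<Longrightarrow> complex_polynomial_in V (f i)) \<Longrightarrow> complex_polynomial_in V (\<lambda>y. \<Sum>i\<in>I. f i y)"
  by (simp add: complex_polynomial_in_def polynomial_in_sum)

lemma complex_polynomial_in_prod:
  assumes "finite V" "\<And>i. i \<in> I \<Longrightarrow> complex_polynomial_in V (f i)"
  shows "complex_polynomial_in V (\<lambda>y. \<Prod>i\<in>I. f i y)"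
  using assms(2)
  by (induction I rule: infinite_finite_induct)
     (auto intro: complex_polynomial_in_mult complex_polynomial_in_const[OF assms(1)])

lemma complex_polynomial_in_power:
  assumes "finite V" "complex_polynomial_in V f"
  shows "complex_polynomial_in V (\<lambda>y. f y ^ j)"
  using complex_polynomial_in_prod[of V "{..<j}" "\<lambda>_. f"] assms by simp

definition base_point_of :: "((complex ^ 'm::finite, 'm, 'k) parameter \<Rightarrow> real) \<Rightarrow> complex ^ 'm" where
  "base_point_of y = (\<Sum>b\<in>Basis. y (Base_point b) *\<^sub>R b)"

definition components_of ::
    "((complex ^ 'm::finite, 'm, 'k) parameter \<Rightarrow> real) \<Rightarrow> 'k option \<Rightarrow> ('m \<Rightarrow> nat) \<Rightarrow> complex" where
  "components_of y j \<gamma> = Complex (y (Component j \<gamma> True)) (y (Component j \<gamma> False))"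

definition parametrized_value ::
    "nat \<Rightarrow> complex ^ 'm::finite \<Rightarrow> ((complex ^ 'm, 'm, 'k::finite) parameter \<Rightarrow> real) \<Rightarrow> real" where
  "parametrized_value k x y =
     jet_product k (\<lambda>\<alpha>. y (Multiplier \<alpha>)) (components_of y) (\<lambda>j. y (Sign j)) (x - base_point_of y)"

lemma polynomial_in_parametrized_value:
  fixes x :: "complex ^ 'm::finite"
  shows "polynomial_in (parameters k :: (complex ^ 'm, 'm, 'k::finite) parameter set) (parametrized_value k x)"
proof -
  let ?Y = "parameters k :: (complex ^ 'm, 'm, 'k) parameter set"
  have fin: "finite ?Y" by (rule finite_parameters)
  have coord: "polynomial_in ?Y (\<lambda>y. (x - base_point_of y) \<bullet> b)" if b: "b \<in> Basis" for b
  proof -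
    have "(x - base_point_of y) \<bullet> b = x \<bullet> b - y (Base_point b)" for y :: "(complex ^ 'm, 'm, 'k) parameter \<Rightarrow> real"
      using b by (simp add: base_point_of_def inner_diff_left inner_sum_left_Basis)
    moreover have "Base_point b \<in> ?Y" using b by (simp add: parameters_def)
    ultimately show ?thesis
      by (simp add: polynomial_in_diff polynomial_in_const polynomial_in_var fin)
  qed
  \<comment> \<open>The bound \<open>k - 1\<close> is the one built into \<open>parameters\<close>,
    and it suffices because the jet product uses \<open>l < i\<close> with
    \<open>i <= k\<close>.\<close>
  have real: "polynomial_in ?Y (\<lambda>y. real_form (\<lambda>\<alpha>. y (Multiplier \<alpha>)) l (x - base_point_of y))" if l: "l \<le> k - 1" for l
    unfolding real_form_def
  proof (intro polynomial_in_sum polynomial_in_mult polynomial_in_prod polynomial_in_power polynomial_in_var coord fin)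
    fix \<alpha> :: "complex ^ 'm \<Rightarrow> nat" assume "\<alpha> \<in> homogeneous_exponents Basis l"
    then show "Multiplier \<alpha> \<in> ?Y"
      using l by (auto simp: parameters_def homogeneous_exponents_def degree_exponents_def)
  qed
  have nth: "complex_polynomial_in ?Y (\<lambda>y. (x - base_point_of y) $ v)" for v
  proof -
    \<comment> \<open>Inner products with these two basis vectors are the real and imaginary parts
      of the coordinate \<open>v\<close>.\<close>
    have "axis v 1 \<in> (Basis :: (complex ^ 'm) set)" "axis v \<i> \<in> (Basis :: (complex ^ 'm) set)"
      by (auto simp: axis_in_Basis_iff Basis_complex_def)
    from coord[OF this(1)] coord[OF this(2)] show ?thesis
      by (simp add: complex_polynomial_in_def inner_axis)
  qed
  have complex: "complex_polynomial_in ?Y (\<lambda>y. complex_form (components_of y j) i (x - base_point_of y))"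
    if i: "i \<le> k" for i j
    unfolding complex_form_def
  proof (intro complex_polynomial_in_sum complex_polynomial_in_mult complex_polynomial_in_prod
      complex_polynomial_in_power nth fin)
    fix \<gamma> :: "'m \<Rightarrow> nat" assume "\<gamma> \<in> homogeneous_exponents UNIV i"
    then have \<gamma>: "\<gamma> \<in> degree_exponents UNIV k"
      using i by (simp add: homogeneous_exponents_def degree_exponents_def)
    have "Component j \<gamma> r \<in> ?Y" for r
      unfolding parameters_def
      by (rule UnI1, rule UnI2, rule image_eqI[of _ _ "(j, \<gamma>, r)"]) (simp_all add: \<gamma>)
    then show "complex_polynomial_in ?Y (\<lambda>y. components_of y j \<gamma>)"
      by (simp add: complex_polynomial_in_def components_of_def polynomial_in_var fin)
  qed
  have quadric: "polynomial_in ?Y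
      (\<lambda>y. quadric_form (components_of y) (\<lambda>j. y (Sign j)) i (x - base_point_of y))" if i: "i \<le> k" for i
    unfolding quadric_form_def
  proof (intro polynomial_in_diff polynomial_in_sum polynomial_in_mult polynomial_in_var fin)
    show "polynomial_in ?Y (\<lambda>y. Im (complex_form (components_of y None) i (x - base_point_of y)))"
      using complex[OF i] by (simp add: complex_polynomial_in_def)
    show "Sign j \<in> ?Y" for j by (simp add: parameters_def)
    fix j l assume "l \<in> {..i}"
    then have "l \<le> k" "i - l \<le> k" using i by auto
    then have "complex_polynomial_in ?Y (\<lambda>y. complex_form (components_of y (Some j)) l (x - base_point_of y) *
        cnj (complex_form (components_of y (Some j)) (i - l) (x - base_point_of y)))"
      by (intro complex_polynomial_in_mult complex_polynomial_in_cnj complex)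
    then show "polynomial_in ?Y (\<lambda>y. Re (complex_form (components_of y (Some j)) l (x - base_point_of y) *
        cnj (complex_form (components_of y (Some j)) (i - l) (x - base_point_of y))))"
      by (simp add: complex_polynomial_in_def)
  qed
  show ?thesis
    unfolding parametrized_value_def jet_product_def
    by (intro polynomial_in_sum polynomial_in_mult real quadric fin) auto
qed

lemma embeddable_imp_parametrized:
  fixes P :: "(complex ^ 'm::finite \<Rightarrow>\<^sub>0 nat) \<Rightarrow>\<^sub>0 real" and L :: "'k::finite set"
  assumes "P \<in> real_polynomials k" "1 \<le> k" "transversally_embeddable (algebraic_hypersurface P) L"
  obtains y :: "(complex ^ 'm, 'm, 'k) parameter \<Rightarrow> real"
  where "\<And>x. polynomial_fun P x = parametrized_value k x y"
proof -
  obtain p \<beta> and c :: "'k option \<Rightarrow> _" and \<epsilon> where eq: "\<And>x. polynomial_fun P x = jet_product k \<beta> c \<epsilon> (x - p)"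
    using embeddable_imp_jet_product[OF assms] by blast
  define y where "y = case_parameter (\<lambda>b. p \<bullet> b) \<beta> (\<lambda>j \<gamma> r. if r then Re (c j \<gamma>) else Im (c j \<gamma>)) \<epsilon>"
  have "base_point_of y = p" "components_of y = c" "(\<lambda>\<alpha>. y (Multiplier \<alpha>)) = \<beta>" "(\<lambda>j. y (Sign j)) = \<epsilon>"
    by (auto simp: y_def base_point_of_def components_of_def euclidean_representation fun_eq_iff)
  then show ?thesis using that[of y] eq by (simp add: parametrized_value_def)
qed

text \<open>The exceptional set is the zero set of one polynomial \<open>Q\<close>, an algebraic
  relation among the coefficients of all parametrized polynomials.\<close>

lemma generic_not_embeddable:
  assumes "1 \<le> n" "n < N" "CARD('m::finite) = n + 1" "CARD('k::finite) = N" "mu_bound n N \<le> k"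
  shows "zariski_generic_hypersurface k
    (\<lambda>M :: (complex ^ 'm) set. \<not> (\<exists>L :: 'k set. transversally_embeddable M L))"
proof -
  let ?X = "basis_monomials k :: (complex ^ 'm \<Rightarrow>\<^sub>0 nat) set"
  let ?Y = "parameters k :: (complex ^ 'm, 'm, 'k) parameter set"
  let ?R = "real_polynomials k :: ((complex ^ 'm \<Rightarrow>\<^sub>0 nat) \<Rightarrow>\<^sub>0 real) set"
  have k: "1 \<le> k" using mu_bound_ge[OF assms(1,2)] assms(5) by (cases k) auto
  have X: "finite ?X"
    using bij_betw_finite[OF basis_monomials_bij] finite_degree_exponents[OF finite_Basis] by blast
  obtain W :: "(complex ^ 'm \<Rightarrow>\<^sub>0 nat) \<Rightarrow> (complex ^ 'm \<Rightarrow> nat) \<Rightarrow> real" where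
    W: "\<And>P m. P \<in> ?R \<Longrightarrow> m \<in> ?X \<Longrightarrow> Poly_Mapping.lookup P m =
      (\<Sum>J\<in>cube_exponents Basis k. W m J * polynomial_fun P (grid_point J))"
    by (rule coefficients_from_grid_values[of k, where 'a = "complex ^ 'm"]) blast
  \<comment> \<open>The coefficient at \<open>m\<close> as a polynomial in the parameters, read off
    from grid values.\<close>
  define \<psi> :: "_ \<Rightarrow> ((complex ^ 'm, 'm, 'k) parameter \<Rightarrow> real) \<Rightarrow> real"
    where "\<psi> m y = (\<Sum>J\<in>cube_exponents Basis k. W m J * parametrized_value k (grid_point J) y)" for m y
  have "polynomial_in ?Y (\<psi> m)" for m
    unfolding \<psi>_def[abs_def]
    by (intro polynomial_in_sum polynomial_in_mult polynomial_in_const polynomial_in_parametrized_value finite_parameters)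
  then obtain D c where c: "\<exists>\<beta>\<in>cube_exponents ?X D. c \<beta> \<noteq> 0"
    and dep: "\<And>y. (\<Sum>\<beta>\<in>cube_exponents ?X D. c \<beta> * (\<Prod>m\<in>?X. \<psi> m y ^ \<beta> m)) = 0"
    using algebraic_dependence[OF X finite_parameters card_parameters_less[OF assms], of \<psi>] by blast
  define Q where "Q = Abs_poly_mapping (\<lambda>\<mu>. if Poly_Mapping.lookup \<mu> \<in> cube_exponents ?X D
    then c (Poly_Mapping.lookup \<mu>) else 0)"
  have fin: "finite {\<mu>. (if Poly_Mapping.lookup \<mu> \<in> cube_exponents ?X D then c (Poly_Mapping.lookup \<mu>) else 0) \<noteq> 0}"
  proof (rule finite_subset)
    show "finite (Poly_Mapping.lookup -` cube_exponents ?X D)"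
      by (rule finite_vimageI[OF finite_cube_exponents[OF X]]) (simp add: inj_on_def Poly_Mapping.lookup_inject)
  qed auto
  have Q: "Poly_Mapping.lookup Q \<mu> = (if Poly_Mapping.lookup \<mu> \<in> cube_exponents ?X D then c (Poly_Mapping.lookup \<mu>) else 0)"
    for \<mu> unfolding Q_def by (simp only: lookup_Abs_poly_mapping[OF fin])
  have evalQ: "polynomial_eval Q x = (\<Sum>\<beta>\<in>cube_exponents ?X D. c \<beta> * (\<Prod>m\<in>?X. x m ^ \<beta> m))" for x
  proof (subst polynomial_eval_cube[OF X])
    show "Poly_Mapping.lookup \<mu> \<in> cube_exponents ?X D" if "\<mu> \<in> Poly_Mapping.keys Q" for \<mu>
      using that by (simp add: in_keys_iff Q split: if_splits)
    have "Poly_Mapping.lookup (Abs_poly_mapping \<beta>) = \<beta>" if "\<beta> \<in> cube_exponents ?X D" for \<beta>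
      using that by (intro lookup_Abs_poly_mapping finite_subset[OF _ X]) (auto simp: cube_exponents_def)
    then show "(\<Sum>\<beta>\<in>cube_exponents ?X D. Poly_Mapping.lookup Q (Abs_poly_mapping \<beta>) * (\<Prod>m\<in>?X. x m ^ \<beta> m)) =
      (\<Sum>\<beta>\<in>cube_exponents ?X D. c \<beta> * (\<Prod>m\<in>?X. x m ^ \<beta> m))"
      by (intro sum.cong) (auto simp: Q)
  qed
  define Z where "Z = {P \<in> ?R. polynomial_eval Q (Poly_Mapping.lookup P) = 0}"
  have "zariski_closed_in_polynomials k Z"
    unfolding zariski_closed_in_polynomials_def Z_def by (rule exI[of _ "{Q}"]) simp
  moreover have "Z \<subset> ?R"
  proof -
    obtain W' :: "(_ \<Rightarrow> nat) \<Rightarrow> (_ \<Rightarrow> nat) \<Rightarrow> real" where W': "\<And>c \<alpha>. \<alpha> \<in> cube_exponents ?X D \<Longrightarrow>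
      (\<Sum>J\<in>cube_exponents ?X D. W' \<alpha> J * (\<Sum>\<gamma>\<in>cube_exponents ?X D. c \<gamma> * (\<Prod>v\<in>?X. real (J v) ^ \<gamma> v))) = c \<alpha>"
      by (rule grid_coefficient_weights[OF X]) blast
    \<comment> \<open>Properness of the exceptional set: otherwise interpolation would make every
      coefficient of the relation zero. A grid point off the zero set is itself a polynomial with
      natural coefficients.\<close>
    have "\<exists>J\<in>cube_exponents ?X D. polynomial_eval Q (\<lambda>m. real (J m)) \<noteq> 0"
    proof (rule ccontr)
      assume "\<not> ?thesis"
      then have "c \<beta> = 0" if "\<beta> \<in> cube_exponents ?X D" for \<beta>
        using W'[OF that, of c] by (simp add: evalQ)
      then show False using c by blast
    qed
    then obtain J where J: "J \<in> cube_exponents ?X D" "polynomial_eval Q (\<lambda>m. real (J m)) \<noteq> 0" by blast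
    define P0 where "P0 = Abs_poly_mapping (\<lambda>m. real (J m))"
    have P0: "Poly_Mapping.lookup P0 = (\<lambda>m. real (J m))"
      unfolding P0_def using J(1)
      by (intro lookup_Abs_poly_mapping finite_subset[OF _ X]) (auto simp: cube_exponents_def)
    have "P0 \<in> ?R"
      using J(1) by (force simp: real_polynomials_def in_keys_iff P0 cube_exponents_def basis_monomials_def)
    moreover have "P0 \<notin> Z" using J(2) by (simp add: Z_def P0)
    moreover have "Z \<subseteq> ?R" by (auto simp: Z_def)
    ultimately show ?thesis by blast
  qed
  moreover have "\<not> (\<exists>L :: 'k set. transversally_embeddable (algebraic_hypersurface P) L)" if P: "P \<in> ?R - Z" for P
  proof
    assume "\<exists>L :: 'k set. transversally_embeddable (algebraic_hypersurface P) L"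
    then obtain y :: "(complex ^ 'm, 'm, 'k) parameter \<Rightarrow> real"
      where y: "\<And>x. polynomial_fun P x = parametrized_value k x y"
      using embeddable_imp_parametrized[of P k] P k by blast
    have "Poly_Mapping.lookup P m = \<psi> m y" if "m \<in> ?X" for m
      using W[OF _ that, of P] P by (simp add: \<psi>_def y)
    then have "polynomial_eval Q (Poly_Mapping.lookup P) = 0"
      using dep[of y] by (simp add: evalQ)
    then show False using P by (simp add: Z_def)
  qed
  ultimately show ?thesis unfolding zariski_generic_hypersurface_def by blast
qed

theorem theorem2:
  fixes n N :: nat
  assumes "1 \<le> n" and "n < N"
    and "CARD('m::finite) = n + 1" and "CARD('k::finite) = N"
  shows "(\<exists>\<mu>. \<forall>k\<ge>\<mu>. zariski_generic_hypersurface k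
            (\<lambda>M :: (complex ^ 'm) set. \<not> (\<exists>L :: 'k set. transversally_embeddable M L)))
       \<and> (\<forall>k\<ge>mu_bound n N. zariski_generic_hypersurface k
            (\<lambda>M :: (complex ^ 'm) set. \<not> (\<exists>L :: 'k set. transversally_embeddable M L)))"
  using generic_not_embeddable[OF assms] by blast

end
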